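(* Let $\mathbb{K}$ be a (commutative) field with at least three elements and let $n$ be a positive integer. Then the irreducible maximal linear subspaces of $\mathrm{M}_n(\mathbb{K})$ with a trivial spectrum are exactly the subspaces of the form $P\,\mathrm{A}_n(\mathbb{K}) = \{PA \mid A \in \mathrm{A}_n(\mathbb{K})\}$ where $P \in \mathrm{GL}_n(\mathbb{K})$ is a non-isotropic matrix.
   Context: $\mathrm{M}_n(\mathbb{K})$ is the algebra of $n\times n$ matrices over $\mathbb{K}$, and $\mathrm{A}_n(\mathbb{K})$ is the space of alternate matrices, i.e. those $A$ with $X^TAX=0$ for all $X\in\mathbb{K}^n$ (skew-symmetric with zero diagonal). A matrix $P\in \mathrm{M}_n(\mathbb{K})$ is non-isotropic if $X^TPX\neq 0$ for all $X\in\mathbb{K}^n\setminus\{0\}$. A linear subspace $H$ of $\mathrm{M}_n(\mathbb{K})$ has a trivial spectrum if no matrix $M\in H$ has a non-zero vector $X\in\mathbb{K}^n$ with $MX=X$ (equivalently, no matrix of $H$ has a non-zero eigenvalue in $\mathbb{K}$). Such a subspace is called maximal if its dimension is $\binom{n}{2}$. A maximal linear subspace with a trivial spectrum is irreducible if the only linear subspaces of $\mathbb{K}^n$ that are stabilized by all its matrices are $\{0\}$ and $\mathbb{K}^n$. *)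

theory Defs
  imports "HOL-Analysis.Analysis"
begin

definition mat_scale :: "'a::field \<Rightarrow> 'a^'n^'n \<Rightarrow> 'a^'n^'n" where
  "mat_scale c A = (\<chi> i j. c * A $ i $ j)"

definition mat_unit :: "'n \<Rightarrow> 'n \<Rightarrow> 'a::field^'n^'n" where
  "mat_unit p q = (\<chi> i j. if i = p \<and> j = q then 1 else 0)"

definition mat_units :: "('a::field^'n^'n) set" where
  "mat_units = range (\<lambda>(p, q). mat_unit p q)"

interpretation mat_vs: vector_space "mat_scale :: 'a::field \<Rightarrow> 'a^'n^'n \<Rightarrow> 'a^'n^'n"
  by unfold_locales (simp_all add: mat_scale_def vec_eq_iff algebra_simps)

lemma mat_unit_nth: "mat_unit p q $ i $ j = (if (i, j) = (p, q) then 1 else 0)"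
  by (simp add: mat_unit_def)

lemma mat_unit_inj: "inj (\<lambda>(p, q). mat_unit p q :: 'a::field^'n^'n)"
proof (rule injI, clarify)
  fix p q r s :: 'n
  assume "(mat_unit p q :: 'a^'n^'n) = mat_unit r s"
  then have "(mat_unit p q :: 'a^'n^'n) $ p $ q = mat_unit r s $ p $ q" by simp
  then show "p = r \<and> q = s" by (simp add: mat_unit_def split: if_splits)
qed

lemma mat_expansion:
  fixes u :: "'n::finite \<Rightarrow> 'n \<Rightarrow> 'a::field"
  shows "(\<Sum>(p, q)\<in>UNIV. mat_scale (u p q) (mat_unit p q)) = (\<chi> i j. u i j)"
proof -
  have "(\<Sum>x\<in>UNIV. u (fst x) (snd x) * (if (i, j) = x then 1 else 0)) = u i j" for i j
    by (simp add: if_distrib cong: if_cong)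
  then show ?thesis
    by (simp add: vec_eq_iff mat_scale_def mat_unit_nth case_prod_unfold prod_eq_iff)
qed

lemma mat_units_independent: "mat_vs.independent (mat_units :: ('a::field^'n^'n) set)"
proof (rule mat_vs.independent_if_scalars_zero)
  show "finite (mat_units :: ('a^'n^'n) set)" by (simp add: mat_units_def)
next
  fix f :: "'a^'n^'n \<Rightarrow> 'a" and x :: "'a^'n^'n"
  assume f: "(\<Sum>x\<in>mat_units. mat_scale (f x) x) = 0" and "x \<in> mat_units"
  then obtain i j where x: "x = mat_unit i j" by (auto simp: mat_units_def)
  have "(\<Sum>x\<in>mat_units. mat_scale (f x) x)
      = (\<Sum>(p, q)\<in>UNIV. mat_scale (f (mat_unit p q)) (mat_unit p q))"
    unfolding mat_units_def
    by (subst sum.reindex[OF mat_unit_inj]) (simp add: o_def case_prod_unfold)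
  also have "\<dots> = (\<chi> i j. f (mat_unit i j))"
    using mat_expansion[of "\<lambda>p q. f (mat_unit p q)"] by simp
  finally have "(\<chi> i j. f (mat_unit i j)) = (0 :: 'a^'n^'n)" using f by simp
  then show "f x = 0" by (simp add: x vec_eq_iff)
qed

lemma mat_units_span: "mat_vs.span (mat_units :: ('a::field^'n^'n) set) = UNIV"
proof -
  have "A \<in> mat_vs.span mat_units" for A :: "'a^'n^'n"
  proof -
    have "A = (\<Sum>(p, q)\<in>UNIV. mat_scale (A $ p $ q) (mat_unit p q))"
      using mat_expansion[of "\<lambda>p q. A $ p $ q"] by simp
    also have "\<dots> \<in> mat_vs.span mat_units"
    proof (rule mat_vs.span_sum, clarify)
      fix p q :: 'n
      have "mat_unit p q \<in> (mat_units :: ('a^'n^'n) set)" by (auto simp: mat_units_def)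
      then show "mat_scale (A $ p $ q) (mat_unit p q) \<in> mat_vs.span mat_units"
        by (intro mat_vs.span_scale mat_vs.span_base)
    qed
    finally show ?thesis .
  qed
  then show ?thesis by auto
qed

interpretation mat_vs: finite_dimensional_vector_space
  "mat_scale :: 'a::field \<Rightarrow> 'a^'n^'n \<Rightarrow> 'a^'n^'n" mat_units
  by unfold_locales
    (simp_all add: mat_units_independent mat_units_span, simp add: mat_units_def)

definition alternate :: "'a::field^'n^'n \<Rightarrow> bool" where
  "alternate A \<longleftrightarrow> (\<forall>X. scalar_product X (A *v X) = 0)"

definition alternate_matrices :: "('a::field^'n^'n) set" where
  "alternate_matrices = {A. alternate A}"

definition non_isotropic :: "'a::field^'n^'n \<Rightarrow> bool" where
  "non_isotropic P \<longleftrightarrow> (\<forall>X. X \<noteq> 0 \<longrightarrow> scalar_product X (P *v X) \<noteq> 0)"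

definition trivial_spectrum :: "('a::field^'n^'n) set \<Rightarrow> bool" where
  "trivial_spectrum H \<longleftrightarrow> \<not> (\<exists>M\<in>H. \<exists>X. X \<noteq> 0 \<and> M *v X = X)"

definition maximal_trivial_spectrum_subspace :: "('a::field^'n^'n) set \<Rightarrow> bool" where
  "maximal_trivial_spectrum_subspace H \<longleftrightarrow>
     mat_vs.subspace H \<and> trivial_spectrum H \<and> mat_vs.dim H = CARD('n) choose 2"

definition irreducible_matrices :: "('a::field^'n^'n) set \<Rightarrow> bool" where
  "irreducible_matrices H \<longleftrightarrow>
     (\<forall>W. vec.subspace W \<and> (\<forall>M\<in>H. \<forall>X\<in>W. M *v X \<in> W) \<longrightarrow> W = {0} \<or> W = UNIV)"

end

theory Submission
  imports Defs
begin

text \<open>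
  Let \<open>V\<close> be a maximal space with a trivial spectrum on \<open>E\<close>, of dimension \<open>n\<close>, and write
  \<open>V x = {M x | M \<in> V}\<close> (\<open>orbit\<close> below) and \<open>W\<^sub>x = {M \<in> V. M x = 0}\<close> (\<open>annihilator\<close>, with
  \<open>W\<^sub>x y\<close> being \<open>annihilator_orbit\<close>). Call \<open>x\<close> bad if \<open>V\<close> contains a nonzero matrix
  with range in the line of \<open>x\<close>. Bad vectors never span \<open>E\<close>: given a basis of bad vectors with
  matrices \<open>M\<^sub>i\<close>, some combination of the \<open>M\<^sub>i\<close> fixes a partial sum of the basis. If \<open>x\<close> is not bad,
  then \<open>W\<^sub>x\<close> has a trivial spectrum on \<open>E / K x\<close> and acts faithfully there; by induction this yields
  \<open>dim V \<le> n choose 2\<close>, and maximality forces \<open>V x\<close> to be a hyperplane, with \<open>x \<notin> V x\<close>.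

  The central fact is that \<open>W\<^sub>x E \<subseteq> V x\<close> for \<open>x\<close> outside the span \<open>B\<close> of the bad vectors (\<open>bad_span\<close>).
  For generic \<open>y\<close> the spaces \<open>W\<^sub>x y\<close> and \<open>W\<^sub>y x\<close> have the same dimension, at least \<open>n - 2\<close>, and both lie in
  \<open>V (x + t y)\<close> for every \<open>t \<noteq> 0\<close>; unless they coincide, their sum is the hyperplane \<open>V (x + t y)\<close>,
  and two distinct values of \<open>t\<close> show that it contains \<open>V x\<close>. A dimension count then shows that \<open>B\<close>
  is invariant under \<open>V\<close>, so \<open>B = 0\<close> in the irreducible case.

  Let then \<open>q(x)\<close> be a normal vector of the hyperplane \<open>V x\<close>. For independent \<open>x\<close>, \<open>y\<close> one gets
  \<open>V x \<inter> V y = W\<^sub>x y = W\<^sub>y x\<close>, hence \<open>q(x) \<cdot> M y = - c(x, y) q(y) \<cdot> M x\<close> for all \<open>M \<in> V\<close>. The constants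
  (\<open>ratio\<close>) satisfy \<open>c(x, z) = c(x, y) c(y, z)\<close>, so the \<open>q(e\<^sub>i)\<close> can be rescaled to the rows of a matrix \<open>G\<close>
  such that \<open>G M\<close> is alternate for all \<open>M \<in> V\<close>, and \<open>P = G\<^sup>-\<^sup>1\<close>.
\<close>

section \<open>Linear algebra\<close>

context finite_dimensional_vector_space_pair
begin

text \<open>Rank-nullity for the restriction of \<open>f\<close> to a subspace: a basis of the
  kernel is extended to a basis of \<open>S\<close>, and \<open>f\<close> is injective on the span
  of the added vectors.\<close>

lemma dim_image_kernel:
  assumes f: "Vector_Spaces.linear s1 s2 f" and S: "vs1.subspace S"
  shows "vs1.dim S = vs2.dim (f ` S) + vs1.dim {x \<in> S. f x = 0}"
proof -
  interpret f: Vector_Spaces.linear s1 s2 f by fact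
  let ?N = "{x \<in> S. f x = 0}"
  have N: "vs1.subspace ?N"
    using S by (auto simp: vs1.subspace_def f.add f.scale)
  obtain A where A: "A \<subseteq> ?N" "vs1.independent A" "?N \<subseteq> vs1.span A"
    using vs1.basis_exists[of ?N] by metis
  obtain C where C: "A \<subseteq> C" "C \<subseteq> S" "vs1.independent C" "S \<subseteq> vs1.span C"
    using vs1.maximal_independent_subset_extend[of A S] A by auto
  have spA: "vs1.span A = ?N"
    using A N by (intro subset_antisym vs1.span_minimal)
  have spC: "vs1.span C = S"
    using C S by (intro subset_antisym vs1.span_minimal)
  have finC: "finite C" using C(3) by (rule vs1.finiteI_independent)
  let ?T = "vs1.span (C - A)"
  have CA: "vs1.independent (C - A)" using C(3) by (rule vs1.independent_mono) auto
  have sums: "{x + y |x y. x \<in> ?T \<and> y \<in> ?N} = S"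
  proof -
    have "vs1.span ((C - A) \<union> A) = {x + y |x y. x \<in> ?T \<and> y \<in> ?N}"
      unfolding vs1.span_Un spA by auto
    moreover have "(C - A) \<union> A = C" using C(1) by auto
    ultimately show ?thesis using spC by simp
  qed
  have "vs1.dim {x + y |x y. x \<in> ?T \<and> y \<in> ?N} + vs1.dim (?T \<inter> ?N) = vs1.dim ?T + vs1.dim ?N"
    by (rule vs1.dim_sums_Int) (auto simp: N)
  moreover have "vs1.dim S = card C"
    using C vs1.basis_card_eq_dim by auto
  moreover have "vs1.dim ?T = card (C - A)"
    using CA by (simp add: vs1.dim_eq_card_independent)
  moreover have "vs1.dim ?N = card A"
    using A vs1.basis_card_eq_dim by auto
  moreover have "card C = card A + card (C - A)"
    using C(1) finC by (metis card_Diff_subset card_mono finite_subset le_add_diff_inverse)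
  ultimately have dN: "vs1.dim S = vs1.dim ?T + vs1.dim ?N" and "vs1.dim (?T \<inter> ?N) = 0"
    unfolding sums by linarith+
  then have TN: "?T \<inter> ?N \<subseteq> {0}" by (simp only: vs1.dim_eq_0)
  have TS: "?T \<subseteq> S" using spC vs1.span_mono[of "C - A" C] by auto
  have "inj_on f ?T"
  proof (rule inj_onI)
    fix x y assume xy: "x \<in> ?T" "y \<in> ?T" "f x = f y"
    then have "x - y \<in> ?T" by (simp add: vs1.span_diff)
    moreover have "f (x - y) = 0" using xy by (simp add: f.diff)
    ultimately have "x - y \<in> ?T \<inter> ?N" using TS by auto
    then show "x = y" using TN by auto
  qed
  then have "vs2.dim (f ` ?T) = vs1.dim ?T"
    using dim_image_eq[OF f, of ?T] by (simp add: vs1.span_span)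
  moreover have "f ` S = f ` ?T"
  proof
    show "f ` S \<subseteq> f ` ?T"
    proof clarify
      fix z assume "z \<in> S"
      then obtain x y where "z = x + y" "x \<in> ?T" "y \<in> ?N" using sums by blast
      then show "f z \<in> f ` ?T" by (simp add: f.add)
    qed
  qed (use TS in auto)
  ultimately show ?thesis using dN by simp
qed

text \<open>Restricting \<open>f\<close> to the part of \<open>S\<close> that it sends into
  \<open>F\<close> keeps the kernel and cuts the image down to its intersection with
  \<open>F\<close>. Two uses of rank-nullity and the formula for the dimension of a sum then give
  the count. It serves to measure the matrices that send a given vector into
  \<open>F\<close>.\<close>

lemma dim_preimage_sum:
  assumes f: "Vector_Spaces.linear s1 s2 f" and S: "vs1.subspace S" and F: "vs2.subspace F"
  shows "vs1.dim S + vs2.dim F = vs1.dim {x \<in> S. f x \<in> F} + vs2.dim (vs2.span (f ` S \<union> F))"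
proof -
  interpret f: Vector_Spaces.linear s1 s2 f by fact
  let ?R = "{x \<in> S. f x \<in> F}"
  have R: "vs1.subspace ?R"
    using S F by (auto simp: vs1.subspace_def vs2.subspace_def f.add f.scale)
  have "{x \<in> ?R. f x = 0} = {x \<in> S. f x = 0}"
    using F by (auto simp: vs2.subspace_0)
  moreover have "f ` ?R = f ` S \<inter> F" by auto
  ultimately have 1: "vs1.dim ?R = vs2.dim (f ` S \<inter> F) + vs1.dim {x \<in> S. f x = 0}"
    using dim_image_kernel[OF f R] by simp
  have fS: "vs2.subspace (f ` S)" using S by (rule f.subspace_image)
  have "vs2.span (f ` S \<union> F) = {x + y |x y. x \<in> f ` S \<and> y \<in> F}"
    unfolding vs2.span_Un using fS F by (metis vs2.span_eq_iff)
  then have "vs2.dim (vs2.span (f ` S \<union> F)) + vs2.dim (f ` S \<inter> F) = vs2.dim (f ` S) + vs2.dim F"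
    using vs2.dim_sums_Int[OF fS F] by simp
  then show ?thesis using 1 dim_image_kernel[OF f S] by simp
qed

end

interpretation mat_vec: finite_dimensional_vector_space_pair
  "mat_scale :: 'a::field \<Rightarrow> 'a^'n^'n \<Rightarrow> 'a^'n^'n" mat_units "(*s) :: 'a \<Rightarrow> 'a^'n \<Rightarrow> 'a^'n" cart_basis ..

interpretation mat_mat: finite_dimensional_vector_space_pair
  "mat_scale :: 'a::field \<Rightarrow> 'a^'n^'n \<Rightarrow> 'a^'n^'n" mat_units
  "mat_scale :: 'a::field \<Rightarrow> 'a^'n^'n \<Rightarrow> 'a^'n^'n" mat_units ..

lemma mat_scale_mult_vec [simp]: "mat_scale c M *v x = c *s (M *v x)"
  by (simp add: mat_scale_def matrix_vector_mult_def vec_eq_iff sum_distrib_left mult.assoc)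

lemma linear_eval: "Vector_Spaces.linear mat_scale (*s) (\<lambda>M :: 'a::field^'n^'n. M *v x)"
  by unfold_locales (simp_all add: matrix_vector_mult_add_rdistrib)

lemma subspace_eval:
  "mat_vs.subspace S \<Longrightarrow> vec.subspace ((\<lambda>M :: 'a::field^'n^'n. M *v x) ` S)"
  using linear_eval by (rule mat_vec.linear_subspace_image)

lemma subspace_full_dim:
  fixes F :: "('a::field^'n) set"
  assumes "vec.subspace F" "CARD('n) \<le> vec.dim F"
  shows "F = UNIV"
  using assms vec.subspace_dim_equal[of F UNIV] unfolding vec_dim_card by auto

lemma Suc_choose_two: "Suc m choose 2 = m + (m choose 2)"
  by (simp add: numeral_2_eq_2)

lemma inverse_smult: "c \<noteq> 0 \<Longrightarrow> inverse c *s (c *s v) = (v :: 'a::field^'n)"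
  by (simp add: vector_smult_assoc)

text \<open>Fix \<open>y\<close> outside both subspaces and let \<open>z\<close> lie in one of them.
  The points \<open>y + t z\<close> all avoid that subspace, and for \<open>t = 1\<close> or
  \<open>t = s\<close> also the other, since otherwise \<open>(s - 1) y\<close> would lie in it.
  Subtracting \<open>y\<close> recovers \<open>z\<close>. This is one of the two places where a
  third field element is used: over two elements, the vectors off both axes of the plane do not span
  it.\<close>

lemma outside_two_subspaces_spanning:
  fixes A B N :: "('a::field^'n) set"
  assumes three: "\<exists>a b c :: 'a. a \<noteq> b \<and> a \<noteq> c \<and> b \<noteq> c"
    and A: "vec.subspace A" "A \<noteq> UNIV" and B: "vec.subspace B" "B \<noteq> UNIV"
    and N: "vec.subspace N" "\<And>y. y \<notin> A \<Longrightarrow> y \<notin> B \<Longrightarrow> y \<in> N"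
  shows "N = UNIV"
proof -
  obtain s :: 'a where s: "s \<noteq> 0" "s \<noteq> 1" using three by metis
  obtain y where y: "y \<notin> A" "y \<notin> B"
  proof -
    obtain a b where a: "a \<notin> A" and b: "b \<notin> B" using A(2) B(2) by blast
    show thesis
    proof (cases "a \<in> B \<and> b \<in> A")
      case True
      then have "a + b \<notin> A" "a + b \<notin> B"
        using a b vec.subspace_diff[OF A(1), of "a + b" b] vec.subspace_diff[OF B(1), of "a + b" a]
        by auto
      then show thesis by (rule that)
    next
      case False
      then show thesis using a b that by blast
    qed
  qed
  have half: "z \<in> N" if C: "vec.subspace C" "y \<notin> C" "z \<in> C" and D: "vec.subspace D" "y \<notin> D"
    and N': "\<And>v. v \<notin> C \<Longrightarrow> v \<notin> D \<Longrightarrow> v \<in> N" for C D z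
  proof -
    have notC: "y + t *s z \<notin> C" for t
      using vec.subspace_diff[OF C(1), of "y + t *s z" "t *s z"] vec.subspace_scale[OF C(1,3)] C(2)
      by auto
    have "\<exists>t. t \<noteq> 0 \<and> y + t *s z \<notin> D"
    proof (rule ccontr)
      assume "\<not> ?thesis"
      then have 1: "y + 1 *s z \<in> D" and 2: "y + s *s z \<in> D" using s zero_neq_one[where 'a='a] by metis+
      have "s *s (y + 1 *s z) - (y + s *s z) \<in> D"
        by (rule vec.subspace_diff[OF D(1) vec.subspace_scale[OF D(1) 1] 2])
      moreover have "s *s (y + 1 *s z) - (y + s *s z) = (s - 1) *s y"
        by (simp add: vec_eq_iff algebra_simps)
      ultimately have "inverse (s - 1) *s ((s - 1) *s y) \<in> D"
        using vec.subspace_scale[OF D(1)] by metis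
      then show False using s(2) D(2) by (simp only: not_False_eq_True inverse_smult right_minus_eq)
    qed
    then obtain t where t: "t \<noteq> 0" "y + t *s z \<notin> D" by blast
    have tz: "(y + t *s z) - y \<in> N"
      by (rule vec.subspace_diff[OF N(1) N'[OF notC t(2)] N'[OF C(2) D(2)]])
    have "inverse t *s ((y + t *s z) - y) \<in> N"
      by (rule vec.subspace_scale[OF N(1) tz])
    then show ?thesis using t(1) by (simp only: not_False_eq_True inverse_smult add_diff_cancel_left')
  qed
  have "z \<in> N" for z
  proof -
    consider "z \<in> A" | "z \<in> B" | "z \<notin> A" "z \<notin> B" by blast
    then show ?thesis
      by cases (use half[of A z B] half[of B z A] A(1) B(1) y N(2) in blast)+
  qed
  then show ?thesis by blast
qed

section \<open>Scalar products, functionals and orthogonal subspaces\<close>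

lemma scalar_product_linear:
  fixes v w :: "'a::field^'n"
  shows "scalar_product (u + v) w = scalar_product u w + scalar_product v w"
    "scalar_product u (v + w) = scalar_product u v + scalar_product u w"
    "scalar_product (u - v) w = scalar_product u w - scalar_product v w"
    "scalar_product u (v - w) = scalar_product u v - scalar_product u w"
    "scalar_product (c *s v) w = c * scalar_product v w"
    "scalar_product v (c *s w) = c * scalar_product v w"
    "scalar_product 0 w = 0" "scalar_product v 0 = 0"
  by (simp_all add: scalar_product_def algebra_simps sum.distrib sum_subtractf sum_distrib_left)

lemma scalar_product_commute: "scalar_product v w = scalar_product w (v :: 'a::field^'n)"
  by (simp add: scalar_product_def mult.commute)

lemma scalar_product_axis: "scalar_product v (axis i 1) = (v :: 'a::field^'n) $ i"
  by (simp add: scalar_product_def axis_def if_distrib cong: if_cong)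

lemma exists_separating_functional:
  fixes H :: "('a::field^'n) set"
  assumes H: "vec.subspace H" and x: "x \<notin> H"
  obtains q where "\<And>h. h \<in> H \<Longrightarrow> scalar_product q h = 0" "scalar_product q x = 1"
proof -
  obtain A where A: "A \<subseteq> H" "vec.independent A" "H \<subseteq> vec.span A"
    using vec.basis_exists[of H] by metis
  have spA: "vec.span A = H" using A H by (intro subset_antisym vec.span_minimal)
  then have "vec.independent (insert x A)"
    using A(2) x by (simp add: vec.independent_insert)
  \<comment> \<open>The functional is realised as a linear map into the line of
    \<open>axis undefined 1\<close>, where \<open>undefined\<close> is merely some index; the
    corresponding row of its matrix is the vector sought.\<close>
  then obtain g where g: "Vector_Spaces.linear (*s) (*s) g"
      "\<And>b. b \<in> insert x A \<Longrightarrow> g b = (if b = x then axis undefined 1 else (0 :: 'a^'n))"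
    using vec.linear_independent_extend[of "insert x A"
        "\<lambda>b. if b = x then axis undefined 1 else (0 :: 'a^'n)"] by metis
  define q where "q = matrix g $ undefined"
  have q: "scalar_product q v = g v $ undefined" for v
    unfolding matrix_works[OF g(1), of v, symmetric]
    by (simp add: q_def scalar_product_def matrix_vector_mult_def)
  have "scalar_product q h = 0" if "h \<in> H" for h
  proof -
    have "x \<notin> A" using A(1) x by blast
    then have "A \<subseteq> {v. g v = 0}" using g(2) by auto
    moreover have "vec.subspace {v. g v = 0}"
      using g(1) by (rule vec.linear_subspace_kernel)
    ultimately have "vec.span A \<subseteq> {v. g v = 0}" by (rule vec.span_minimal)
    then have "g h = 0" using that spA by blast
    then show ?thesis by (simp add: q)
  qed
  moreover have "scalar_product q x = 1" using g(2)[of x] by (simp add: q)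
  ultimately show thesis by (rule that)
qed

lemma scalar_product_matrix_vector:
  "scalar_product u (M *v v) = scalar_product (u v* M) (v :: 'a::field^'n)"
proof -
  have "scalar_product u (M *v v) = (\<Sum>i\<in>UNIV. \<Sum>j\<in>UNIV. u $ i * (M $ i $ j * v $ j))"
    by (simp add: scalar_product_def matrix_vector_mult_def sum_distrib_left)
  also have "\<dots> = (\<Sum>j\<in>UNIV. \<Sum>i\<in>UNIV. u $ i * (M $ i $ j * v $ j))"
    by (rule sum.swap)
  also have "\<dots> = scalar_product (u v* M) v"
    by (simp add: scalar_product_def vector_matrix_mult_def sum_distrib_left mult_ac)
  finally show ?thesis .
qed

lemma subspace_orthogonal: "vec.subspace {y :: 'a::field^'n. \<forall>s\<in>S. scalar_product s y = 0}"
  by (simp add: vec.subspace_def scalar_product_linear)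

text \<open>Each further linear equation lowers the dimension by at most one.\<close>

lemma dim_orthogonal_finite:
  fixes S :: "('a::field^'n) set"
  assumes "finite S"
  shows "CARD('n) \<le> vec.dim {y. \<forall>s\<in>S. scalar_product s y = 0} + card S"
  using assms
proof (induction S rule: finite_induct)
  case empty
  show ?case using vec_dim_card[where 'a='a and 'n='n] by simp
next
  case (insert a S)
  let ?T = "{y. \<forall>s\<in>S. scalar_product s y = 0}"
  let ?f = "\<lambda>y. scalar_product a y *s (axis undefined 1 :: 'a^'n)"
  have f: "Vector_Spaces.linear (*s) (*s) ?f"
    by unfold_locales (simp_all add: scalar_product_linear vec.scale_left_distrib vector_smult_assoc)
  have "vec.dim ?T = vec.dim (?f ` ?T) + vec.dim {y \<in> ?T. ?f y = 0}"
    by (rule vec.dim_image_kernel[OF f subspace_orthogonal])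
  moreover have "vec.dim (?f ` ?T) \<le> card {axis undefined 1 :: 'a^'n}"
    by (rule vec.dim_le_card) (auto simp: vec.span_singleton)
  moreover have "{y \<in> ?T. ?f y = 0} = {y. \<forall>s\<in>insert a S. scalar_product s y = 0}"
    by (auto simp: axis_eq_0_iff)
  ultimately show ?case using insert by simp
qed

lemma dim_orthogonal:
  fixes U :: "('a::field^'n) set"
  shows "CARD('n) \<le> vec.dim {y. \<forall>s\<in>U. scalar_product s y = 0} + vec.dim U"
proof -
  obtain A where A: "A \<subseteq> U" "vec.independent A" "U \<subseteq> vec.span A" "card A = vec.dim U"
    using vec.basis_exists[of U] by metis
  have "scalar_product s y = 0" if s: "s \<in> U" and y: "\<forall>s\<in>A. scalar_product s y = 0" for s y
  proof -
    have "A \<subseteq> {s. scalar_product s y = 0}" using y by blast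
    moreover have "vec.subspace {s. scalar_product s y = 0}"
      by (simp add: vec.subspace_def scalar_product_linear)
    ultimately have "vec.span A \<subseteq> {s. scalar_product s y = 0}" by (rule vec.span_minimal)
    then show ?thesis using s A(3) by blast
  qed
  then have "{y. \<forall>s\<in>A. scalar_product s y = 0} \<subseteq> {y. \<forall>s\<in>U. scalar_product s y = 0}"
    by blast
  then have "vec.dim {y. \<forall>s\<in>A. scalar_product s y = 0} \<le> vec.dim {y. \<forall>s\<in>U. scalar_product s y = 0}"
    by (rule vec.dim_subset)
  then show ?thesis
    using dim_orthogonal_finite[OF vec.finiteI_independent[OF A(2)]] A(4) by linarith
qed

section \<open>Alternate matrices\<close>

text \<open>The row and the column of a new index cancel. The diagonal is a separate hypothesis
  because antisymmetry does not force it to vanish in characteristic 2.\<close>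

lemma sum_antisymmetric:
  fixes h :: "'b \<Rightarrow> 'b \<Rightarrow> 'a::ab_group_add"
  assumes "finite I" "\<And>i. h i i = 0" "\<And>i j. h i j = - h j i"
  shows "(\<Sum>i\<in>I. \<Sum>j\<in>I. h i j) = 0"
  using assms(1)
proof (induction I rule: finite_induct)
  case (insert a I)
  have "(\<Sum>j\<in>I. h a j) = (\<Sum>i\<in>I. - h i a)"
    by (rule sum.cong[OF refl assms(3)])
  then show ?case using insert by (simp add: assms(2) sum.distrib sum_negf)
qed simp

lemma scalar_product_mult_vec:
  fixes A :: "'a::field^'n^'n"
  shows "scalar_product X (A *v Y) = (\<Sum>i\<in>UNIV. \<Sum>j\<in>UNIV. X $ i * (A $ i $ j * Y $ j))"
  by (simp add: scalar_product_def matrix_vector_mult_def sum_distrib_left)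

lemma mult_axis_nth: "((A :: 'a::field^'n^'n) *v axis j 1) $ i = A $ i $ j"
  by (simp add: matrix_vector_mult_def axis_def if_distrib cong: if_cong)

lemma scalar_product_axis_mult:
  fixes A :: "'a::field^'n^'n"
  shows "scalar_product (axis i 1) (A *v axis j 1) = A $ i $ j"
  by (simp add: scalar_product_commute[of "axis i 1"] scalar_product_axis mult_axis_nth)

text \<open>Testing on \<open>axis i 1\<close> gives the diagonal, and polarization at
  \<open>axis i 1 + axis j 1\<close> gives skew symmetry; conversely, the double sum cancels in
  pairs. The form covers characteristic 2.\<close>

lemma alternate_iff:
  fixes A :: "'a::field^'n^'n"
  shows "alternate A \<longleftrightarrow> (\<forall>i. A $ i $ i = 0) \<and> (\<forall>i j. A $ i $ j = - A $ j $ i)"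
proof
  assume A: "alternate A"
  have diag: "A $ i $ i = 0" for i
    using A[unfolded alternate_def, rule_format, of "axis i 1"] by (simp add: scalar_product_axis_mult)
  have "A $ i $ j = - A $ j $ i" for i j
  proof -
    have "scalar_product (axis i 1 + axis j 1) (A *v (axis i 1 + axis j 1)) = 0"
      using A by (simp add: alternate_def)
    then have "A $ j $ i + A $ i $ j = 0"
      by (simp add: vec.add scalar_product_linear scalar_product_axis_mult diag)
    then show ?thesis by (simp add: eq_neg_iff_add_eq_0 add.commute)
  qed
  then show "(\<forall>i. A $ i $ i = 0) \<and> (\<forall>i j. A $ i $ j = - A $ j $ i)" using diag by blast
next
  assume A: "(\<forall>i. A $ i $ i = 0) \<and> (\<forall>i j. A $ i $ j = - A $ j $ i)"
  show "alternate A"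
    unfolding alternate_def scalar_product_mult_vec
  proof (intro allI sum_antisymmetric)
    fix X :: "'a^'n" and i j
    show "X $ i * (A $ i $ i * X $ i) = 0" using A by simp
    have "A $ i $ j = - A $ j $ i" using A by blast
    then show "X $ i * (A $ i $ j * X $ j) = - (X $ j * (A $ j $ i * X $ i))" by simp
  qed simp
qed

lemma alternate_skew:
  "alternate A \<Longrightarrow> scalar_product X (A *v Y) = - scalar_product Y (A *v (X :: 'a::field^'n))"
proof -
  assume A: "alternate A"
  have "scalar_product (X + Y) (A *v (X + Y)) = 0" "scalar_product X (A *v X) = 0"
    "scalar_product Y (A *v Y) = 0"
    using A by (simp_all add: alternate_def)
  then have "scalar_product Y (A *v X) + scalar_product X (A *v Y) = 0"
    by (simp add: vec.add scalar_product_linear)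
  then show ?thesis by (simp add: eq_neg_iff_add_eq_0 add.commute)
qed

lemma subspace_alternate: "mat_vs.subspace (alternate_matrices :: ('a::field^'n^'n) set)"
  unfolding mat_vs.subspace_def alternate_matrices_def alternate_def mem_Collect_eq
  by (simp add: matrix_vector_mult_add_rdistrib scalar_product_linear)

text \<open>With \<open>w\<close> normalised by \<open>scalar_product w u = 1\<close>, the rank-two
  matrix \<open>v w^T - w v^T\<close> sends \<open>u\<close> to \<open>v\<close>, as
  \<open>v\<close> is orthogonal to \<open>u\<close>.\<close>

lemma exists_alternate_mapping:
  fixes u v :: "'a::field^'n"
  assumes u: "u \<noteq> 0" and uv: "scalar_product v u = 0"
  obtains A where "alternate A" "A *v u = v"
proof -
  obtain w where w: "scalar_product w u = 1"
    using exists_separating_functional[of "{0}" u] u by (metis singletonD vec.subspace_single_0)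
  define A where "A = (\<chi> i j. v $ i * w $ j - w $ i * v $ j)"
  have "alternate A" unfolding alternate_iff A_def by (simp add: mult.commute)
  moreover have "A *v X = scalar_product w X *s v - scalar_product v X *s w" for X
    by (simp add: A_def vec_eq_iff matrix_vector_mult_def scalar_product_def algebra_simps
        sum_subtractf sum_distrib_left)
  then have "A *v u = v" using w uv by simp
  ultimately show thesis by (rule that)
qed

lemma dim_supported:
  fixes I :: "'n::finite set"
  shows "vec.dim {v :: 'a::field^'n. \<forall>i. i \<notin> I \<longrightarrow> v $ i = 0} = card I"
proof -
  let ?T = "(\<lambda>i. axis i 1 :: 'a^'n) ` I"
  let ?U = "{v :: 'a^'n. \<forall>i. i \<notin> I \<longrightarrow> v $ i = 0}"
  have "vec.independent ?T"
    by (rule vec.independent_mono[OF independent_cart_basis]) (auto simp: cart_basis_def)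
  moreover have "?T \<subseteq> ?U" by (auto simp: axis_def)
  moreover have "?U \<subseteq> vec.span ?T"
  proof
    fix v assume v: "v \<in> ?U"
    have "v = (\<Sum>i\<in>UNIV. v $ i *s axis i 1)" by (simp add: basis_expansion)
    also have "\<dots> \<in> vec.span ?T"
    proof (rule vec.span_sum)
      fix i show "v $ i *s axis i 1 \<in> vec.span ?T"
        by (cases "i \<in> I") (use v in \<open>auto intro: vec.span_scale vec.span_base vec.span_zero\<close>)
    qed
    finally show "v \<in> vec.span ?T" .
  qed
  moreover have "card ?T = card I"
    by (rule card_image) (auto simp: inj_on_def axis_eq_axis)
  ultimately show ?thesis using vec.basis_card_eq_dim[of ?T ?U] by simp
qed

text \<open>Induction on \<open>I\<close>: on matrices supported on \<open>insert a I\<close>,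
  evaluation at \<open>axis a 1\<close> has as kernel those supported on \<open>I\<close> and as
  image the vectors supported on \<open>I\<close>, so the dimension grows by \<open>card I\<close>.
  Only rows are constrained, since skew symmetry carries the condition to columns.\<close>

lemma dim_alternate_supported:
  fixes I :: "'n::finite set"
  shows "mat_vs.dim (alternate_matrices \<inter> {A :: 'a::field^'n^'n. \<forall>i j. i \<notin> I \<longrightarrow> A $ i $ j = 0})
    = card I choose 2"
  using finite[of I]
proof (induction I rule: finite_induct)
  case empty
  have "alternate_matrices \<inter> {A :: 'a^'n^'n. \<forall>i j. i \<notin> {} \<longrightarrow> A $ i $ j = 0} \<subseteq> {0}"
    by (auto simp: vec_eq_iff)
  then have "mat_vs.dim (alternate_matrices \<inter> {A :: 'a^'n^'n. \<forall>i j. i \<notin> {} \<longrightarrow> A $ i $ j = 0}) = 0"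
    by (simp only: mat_vs.dim_eq_0)
  moreover have "card ({} :: 'n set) choose 2 = 0" by (simp add: numeral_2_eq_2)
  ultimately show ?case by (rule trans[OF _ sym])
next
  case (insert a I)
  define D where "D J = alternate_matrices \<inter> {A :: 'a^'n^'n. \<forall>i j. i \<notin> J \<longrightarrow> A $ i $ j = 0}"
    for J :: "'n set"
  have D: "A \<in> D J \<longleftrightarrow> alternate A \<and> (\<forall>i j. i \<notin> J \<longrightarrow> A $ i $ j = 0)" for A J
    by (simp add: D_def alternate_matrices_def)
  have D_skew: "A $ i $ j = - A $ j $ i" if "A \<in> D J" for A J i j
    using that unfolding D alternate_iff by blast
  have sub: "mat_vs.subspace (D (insert a I))"
    unfolding D_def
    by (intro mat_vs.subspace_inter subspace_alternate) (simp add: mat_vs.subspace_def mat_scale_def)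
  have ker: "{A \<in> D (insert a I). A *v axis a 1 = 0} = D I"
  proof (intro set_eqI iffI)
    fix A assume A: "A \<in> {A \<in> D (insert a I). A *v axis a 1 = 0}"
    then have "A $ i $ a = 0" for i using mult_axis_nth[of A a i] by simp
    then have "A $ a $ i = 0" for i using A D_skew[of A "insert a I" a i] by simp
    then have "A $ i $ j = 0" if "i \<notin> I" for i j
      using A that unfolding D by (cases "i = a") simp_all
    then show "A \<in> D I" using A by (simp add: D)
  next
    fix A assume A: "A \<in> D I"
    have "A $ i $ a = 0" for i
      using D_skew[OF A, of i a] A insert.hyps(2) unfolding D by simp
    then have "A *v axis a 1 = 0" by (simp add: vec_eq_iff mult_axis_nth)
    then show "A \<in> {A \<in> D (insert a I). A *v axis a 1 = 0}" using A by (simp add: D)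
  qed
  have im: "(\<lambda>A. A *v axis a 1) ` D (insert a I) = {v. \<forall>i. i \<notin> I \<longrightarrow> v $ i = 0}"
  proof (intro set_eqI iffI)
    fix v assume "v \<in> (\<lambda>A. A *v axis a 1) ` D (insert a I)"
    then obtain A where A: "A \<in> D (insert a I)" "v = A *v axis a 1" by blast
    have "A $ a $ a = 0" using A(1) unfolding D alternate_iff by blast
    then have "v $ i = 0" if "i \<notin> I" for i
      using A that unfolding D by (cases "i = a") (simp_all add: mult_axis_nth)
    then show "v \<in> {v. \<forall>i. i \<notin> I \<longrightarrow> v $ i = 0}" by simp
  next
    fix v :: "'a^'n" assume v: "v \<in> {v. \<forall>i. i \<notin> I \<longrightarrow> v $ i = 0}"
    let ?e = "axis a 1 :: 'a^'n"
    define A where "A = (\<chi> i j. v $ i * ?e $ j - ?e $ i * v $ j)"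
    have "v $ a = 0" using v insert.hyps(2) by simp
    then have "v = A *v ?e" by (simp add: vec_eq_iff mult_axis_nth) (simp add: A_def axis_def)
    moreover have "alternate A" by (simp add: alternate_iff A_def mult.commute)
    moreover have "A $ i $ j = 0" if "i \<notin> insert a I" for i j
      using v that by (simp add: A_def axis_def)
    ultimately show "v \<in> (\<lambda>A. A *v axis a 1) ` D (insert a I)" unfolding D_def alternate_matrices_def by blast
  qed
  have "mat_vs.dim (D I) = card I choose 2" unfolding D_def by (rule insert.IH)
  then have "mat_vs.dim (D (insert a I)) = card I + (card I choose 2)"
    using mat_vec.dim_image_kernel[OF linear_eval sub, of "axis a 1"]
    unfolding ker im dim_supported by linarith
  then show ?case unfolding D_def using insert.hyps by (simp add: Suc_choose_two)
qed

lemma dim_alternate: "mat_vs.dim (alternate_matrices :: ('a::field^'n^'n) set) = CARD('n) choose 2"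
  using dim_alternate_supported[of "UNIV :: 'n set", where 'a='a]
  by (simp add: alternate_matrices_def)

lemma dim_image_invertible:
  fixes P :: "'a::field^'n^'n"
  assumes P: "invertible P"
  shows "mat_vs.dim ((\<lambda>A. P ** A) ` S) = mat_vs.dim S"
    and "mat_vs.subspace S \<Longrightarrow> mat_vs.subspace ((\<lambda>A. P ** A) ` S)"
proof -
  have lin: "Vector_Spaces.linear mat_scale mat_scale (\<lambda>A :: 'a^'n^'n. P ** A)"
    by unfold_locales (simp_all add: vec_eq_iff matrix_matrix_mult_def mat_scale_def
        algebra_simps sum.distrib sum_distrib_left)
  obtain Q where "Q ** P = mat 1" using P invertible_def by blast
  then have "inj (\<lambda>A. P ** A)" by (metis injI matrix_mul_assoc matrix_mul_lid)
  then show "mat_vs.dim ((\<lambda>A. P ** A) ` S) = mat_vs.dim S"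
    by (intro mat_mat.dim_image_eq[OF lin]) (auto intro: inj_on_subset)
  show "mat_vs.subspace S \<Longrightarrow> mat_vs.subspace ((\<lambda>A. P ** A) ` S)"
    by (rule mat_mat.linear_subspace_image[OF lin])
qed

section \<open>Trivial spectrum modulo a subspace\<close>

lemma exists_functional_subset:
  assumes "finite I" "I \<noteq> {}" "\<And>i. i \<in> I \<Longrightarrow> \<exists>j\<in>I. E i j"
  shows "\<exists>J\<subseteq>I. J \<noteq> {} \<and> (\<forall>i\<in>J. \<exists>k\<in>J. \<forall>j\<in>J. E i j \<longleftrightarrow> j = k)"
proof -
  let ?closed = "\<lambda>J. J \<subseteq> I \<and> J \<noteq> {} \<and> (\<forall>i\<in>J. \<exists>j\<in>J. E i j)"
  have "?closed I" using assms by auto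
  then obtain J where J: "?closed J" and min: "\<And>J'. ?closed J' \<Longrightarrow> card J \<le> card J'"
    using ex_has_least_nat[of ?closed I card] by metis
  have finJ: "finite J" using J assms(1) finite_subset by auto
  \<comment> \<open>By minimality, removing \<open>k\<close> leaves some \<open>i\<close> whose only successor in \<open>J\<close> is \<open>k\<close>. As \<open>i\<close> determines
    \<open>k\<close>, choosing such an \<open>i\<close> for each \<open>k\<close> permutes \<open>J\<close>.\<close>
  have "\<exists>i\<in>J. \<forall>j\<in>J. E i j \<longleftrightarrow> j = k" if k: "k \<in> J" for k
  proof (cases "J = {k}")
    case True
    then show ?thesis using J by auto
  next
    case False
    have "\<not> ?closed (J - {k})"
      using min[of "J - {k}"] card_Diff1_less[OF finJ k] by auto
    then show ?thesis using False J k by auto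
  qed
  then obtain g where g: "\<And>k. k \<in> J \<Longrightarrow> g k \<in> J \<and> (\<forall>j\<in>J. E (g k) j \<longleftrightarrow> j = k)"
    by metis
  have "inj_on g J" using g by (metis inj_onI)
  then have "g ` J = J" using g finJ by (intro endo_inj_surj) auto
  then show ?thesis using J g by (metis imageE)
qed

text \<open>Encodes a space acting on the quotient by \<open>F\<close> without forming the quotient:
  \<open>F\<close> is stable, no nonzero class is fixed, and the action on classes is
  faithful.\<close>

definition trivial_spectrum_mod :: "('a::field^'n) set \<Rightarrow> ('a^'n^'n) set \<Rightarrow> bool" where
  "trivial_spectrum_mod F S \<longleftrightarrow> vec.subspace F \<and> mat_vs.subspace S \<and>
     (\<forall>M\<in>S. \<forall>v\<in>F. M *v v \<in> F) \<and>
     (\<forall>M\<in>S. \<forall>z. M *v z - z \<in> F \<longrightarrow> z \<in> F) \<and>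
     (\<forall>M\<in>S. (\<forall>z. M *v z \<in> F) \<longrightarrow> M = 0)"

lemma trivial_spectrum_modD:
  assumes "trivial_spectrum_mod F S"
  shows "vec.subspace F" "mat_vs.subspace S"
    "M \<in> S \<Longrightarrow> v \<in> F \<Longrightarrow> M *v v \<in> F"
    "M \<in> S \<Longrightarrow> M *v z - z \<in> F \<Longrightarrow> z \<in> F"
    "M \<in> S \<Longrightarrow> (\<And>z. M *v z \<in> F) \<Longrightarrow> M = 0"
proof -
  have F: "vec.subspace F" and S: "mat_vs.subspace S"
    and stab: "\<forall>M\<in>S. \<forall>v\<in>F. M *v v \<in> F"
    and fixed: "\<forall>M\<in>S. \<forall>z. M *v z - z \<in> F \<longrightarrow> z \<in> F"
    and faithful: "\<forall>M\<in>S. (\<forall>z. M *v z \<in> F) \<longrightarrow> M = 0"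
    using assms unfolding trivial_spectrum_mod_def by - (elim conjE, assumption)+
  show "vec.subspace F" "mat_vs.subspace S" by (fact F S)+
  show "M *v v \<in> F" if "M \<in> S" "v \<in> F" using that by (rule stab[rule_format])
  show "z \<in> F" if "M \<in> S" "M *v z - z \<in> F" using that by (rule fixed[rule_format])
  show "M = 0" if "M \<in> S" "\<And>z. M *v z \<in> F" using that by (rule faithful[rule_format])
qed

text \<open>Under \<open>trivial_spectrum_mod F S\<close>, faithfulness makes these the vectors
  whose classes span the range of a rank-one operator induced on the quotient by
  \<open>F\<close>.\<close>

definition bad_vectors :: "('a::field^'n) set \<Rightarrow> ('a^'n^'n) set \<Rightarrow> ('a^'n) set" where
  "bad_vectors F S = {x. \<exists>M\<in>S. M \<noteq> 0 \<and> (\<forall>z. M *v z \<in> vec.span (insert x F))}"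

text \<open>Otherwise a basis of the quotient consists of bad vectors. A suitable combination of
  their matrices fixes, modulo \<open>F\<close>, the sum of a nonempty part of that basis, which
  would then lie in \<open>F\<close> against independence.\<close>

lemma bad_vectors_not_spanning:
  fixes F :: "('a::field^'n) set" and S :: "('a^'n^'n) set"
  assumes S: "trivial_spectrum_mod F S" and F: "F \<noteq> UNIV"
  shows "vec.span (F \<union> bad_vectors F S) \<noteq> UNIV"
proof
  assume full: "vec.span (F \<union> bad_vectors F S) = UNIV"
  have subF: "vec.subspace F" and subS: "mat_vs.subspace S"
    and fixF: "\<And>M z. M \<in> S \<Longrightarrow> M *v z - z \<in> F \<Longrightarrow> z \<in> F"
    and stabF: "\<And>M z. M \<in> S \<Longrightarrow> z \<in> F \<Longrightarrow> M *v z \<in> F"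
    and faithful: "\<And>M. M \<in> S \<Longrightarrow> (\<And>z. M *v z \<in> F) \<Longrightarrow> M = 0"
    using trivial_spectrum_modD[OF S] by metis+
  obtain A where A: "A \<subseteq> F" "vec.independent A" "F \<subseteq> vec.span A"
    using vec.basis_exists[of F] by metis
  have spA: "vec.span A = F" using A subF by (intro subset_antisym vec.span_minimal)
  have spF: "vec.span F = F" using subF by simp
  obtain C where C: "A \<subseteq> C" "C \<subseteq> A \<union> bad_vectors F S" "vec.independent C"
      "A \<union> bad_vectors F S \<subseteq> vec.span C"
    using vec.maximal_independent_subset_extend[of A "A \<union> bad_vectors F S"] A by auto
  have "F \<union> bad_vectors F S \<subseteq> vec.span C"
    using C(4) A(3) vec.span_mono[OF C(1)] by auto
  then have spC: "vec.span C = UNIV"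
    using full by (metis top.extremum_uniqueI vec.span_minimal vec.subspace_span)
  have finC: "finite C" using C(3) by (rule vec.finiteI_independent)
  let ?I = "C - A"
  have "\<forall>i\<in>?I. \<exists>M\<in>S. M \<noteq> 0 \<and> (\<forall>z. M *v z \<in> vec.span (insert i F))"
    using C(2) by (auto simp: bad_vectors_def)
  then obtain m where m: "\<And>i. i \<in> ?I \<Longrightarrow> m i \<in> S" "\<And>i. i \<in> ?I \<Longrightarrow> m i \<noteq> 0"
      "\<And>i z. i \<in> ?I \<Longrightarrow> m i *v z \<in> vec.span (insert i F)"
    by metis
  have "?I \<noteq> {}" using spA spC F C(1) by auto
  moreover have "\<exists>j\<in>?I. m i *v j \<notin> F" if i: "i \<in> ?I" for i
  proof (rule ccontr)
    assume "\<not> ?thesis"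
    then have "C \<subseteq> {z. m i *v z \<in> F}" using stabF m(1)[OF i] A(1) by auto
    moreover have "vec.subspace {z. m i *v z \<in> F}"
      using subF by (auto simp: vec.subspace_def vec.add vec.scale)
    ultimately have "vec.span C \<subseteq> {z. m i *v z \<in> F}" by (rule vec.span_minimal)
    then have "m i = 0" using spC faithful[OF m(1)[OF i]] by auto
    then show False using m(2)[OF i] by simp
  qed
  \<comment> \<open>Within \<open>J\<close>, each \<open>m i\<close> is nonzero modulo
    \<open>F\<close> at exactly one basis vector. Hence no cancellation occurs at the sum
    \<open>X\<close>, and \<open>m i *v X\<close> is a nonzero multiple of \<open>i\<close> modulo
    \<open>F\<close>.\<close>
  ultimately obtain J where J: "J \<subseteq> ?I" "J \<noteq> {}"
      and J1: "\<And>i. i \<in> J \<Longrightarrow> \<exists>k\<in>J. \<forall>j\<in>J. m i *v j \<notin> F \<longleftrightarrow> j = k"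
    using exists_functional_subset[of ?I "\<lambda>i j. m i *v j \<notin> F"] finC by blast
  have finJ: "finite J" using J(1) finC finite_subset by blast
  define X where "X = \<Sum>J"
  have "\<exists>k. k \<noteq> 0 \<and> m i *v X - k *s i \<in> F" if i: "i \<in> J" for i
  proof -
    obtain k where k: "k \<in> J" "\<And>j. j \<in> J \<Longrightarrow> m i *v j \<notin> F \<longleftrightarrow> j = k"
      using J1[OF i] by blast
    have X: "X = k + \<Sum>(J - {k})"
      unfolding X_def using finJ k(1) by (simp add: sum.remove)
    have "m i *v \<Sum>(J - {k}) \<in> F"
      unfolding vec.sum using k(2) by (intro vec.subspace_sum[OF subF]) auto
    moreover have "m i *v k = m i *v X - m i *v \<Sum>(J - {k})"
      unfolding X by (simp add: vec.add)
    ultimately have "m i *v X \<notin> F"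
      using k vec.subspace_diff[OF subF] by metis
    moreover obtain a where a: "m i *v X - a *s i \<in> F"
      using m(3)[of i X] i J(1) spF unfolding vec.span_breakdown_eq by auto
    ultimately have "a \<noteq> 0" by auto
    then show ?thesis using a by blast
  qed
  then obtain a where a: "\<And>i. i \<in> J \<Longrightarrow> a i \<noteq> 0" "\<And>i. i \<in> J \<Longrightarrow> m i *v X - a i *s i \<in> F"
    by metis
  \<comment> \<open>The weights undo the factors \<open>a i\<close>, so that \<open>M *v X\<close>
    is congruent to the sum of \<open>J\<close>, which is \<open>X\<close>.\<close>
  define M where "M = (\<Sum>i\<in>J. mat_scale (inverse (a i)) (m i))"
  have "M \<in> S"
    unfolding M_def using m(1) J(1) subS
    by (intro mat_vs.subspace_sum mat_vs.subspace_scale) auto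
  have "M *v X - X = (\<Sum>i\<in>J. inverse (a i) *s (m i *v X - a i *s i))"
  proof -
    have "M *v X = (\<Sum>i\<in>J. inverse (a i) *s (m i *v X))"
      unfolding M_def mat_vec.linear_sum[OF linear_eval[of X]] by simp
    moreover have "X = (\<Sum>i\<in>J. inverse (a i) *s (a i *s i))"
      unfolding X_def
    proof (rule sum.cong[OF refl])
      fix i assume "i \<in> J"
      then show "i = inverse (a i) *s (a i *s i)" using a(1)[of i] by (simp add: vector_smult_assoc)
    qed
    ultimately show ?thesis
      by (simp only: sum_subtractf vec.scale_right_diff_distrib)
  qed
  then have "M *v X - X \<in> F"
    using a(2) by (simp only: vec.subspace_sum vec.subspace_scale subF)
  then have XF: "X \<in> F" using fixF \<open>M \<in> S\<close> by blast
  obtain j where j: "j \<in> J" using J(2) by blast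
  have "j = X - \<Sum>(J - {j})" unfolding X_def using finJ j by (simp add: sum.remove)
  moreover have "X \<in> vec.span (C - {j})"
    using XF spA vec.span_mono[of A "C - {j}"] C(1) J(1) j by auto
  moreover have "\<Sum>(J - {j}) \<in> vec.span (C - {j})"
    using J(1) by (intro vec.span_sum vec.span_base) auto
  ultimately have "j \<in> vec.span (C - {j})" by (metis vec.span_diff)
  then show False using C(3) J(1) j unfolding vec.dependent_def by blast
qed

text \<open>If \<open>M *v z - z\<close> equals \<open>k *s x\<close> modulo \<open>F\<close> and
  \<open>M *v x\<close> lies in \<open>F\<close>, then \<open>z + k *s x\<close> is fixed modulo
  \<open>F\<close>. Faithfulness on the smaller quotient is precisely the condition that
  \<open>x\<close> is not bad.\<close>

lemma trivial_spectrum_mod_extend: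
  fixes F :: "('a::field^'n) set" and S :: "('a^'n^'n) set"
  assumes S: "trivial_spectrum_mod F S" and x: "x \<notin> bad_vectors F S"
  shows "trivial_spectrum_mod (vec.span (insert x F)) {M \<in> S. M *v x \<in> F}"
proof -
  note D = trivial_spectrum_modD[OF S]
  have spF: "vec.span F = F" using D(1) by simp
  have F': "v \<in> vec.span (insert x F) \<longleftrightarrow> (\<exists>k. v - k *s x \<in> F)" for v
    using vec.span_breakdown_eq[of v x F] by (simp only: spF)
  have sub: "mat_vs.subspace {M \<in> S. M *v x \<in> F}"
    using D(1,2) mat_vec.linear_0[OF linear_eval[of x]]
    by (simp add: mat_vs.subspace_def vec.subspace_def matrix_vector_mult_add_rdistrib)
  have stab: "M *v v \<in> vec.span (insert x F)"
    if M: "M \<in> S" "M *v x \<in> F" and v: "v \<in> vec.span (insert x F)" for M v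
  proof -
    obtain k where k: "v - k *s x \<in> F" using v F' by blast
    have "M *v v = M *v (v - k *s x) + k *s (M *v x)"
      by (simp add: vec.diff vec.scale)
    also have "\<dots> \<in> F"
      using D(3)[OF M(1) k] M(2) by (intro vec.subspace_add vec.subspace_scale D(1))
    finally show ?thesis using vec.span_superset[of "insert x F"] by blast
  qed
  have fixed: "z \<in> vec.span (insert x F)"
    if M: "M \<in> S" "M *v x \<in> F" and z: "M *v z - z \<in> vec.span (insert x F)" for M z
  proof -
    obtain k where k: "M *v z - z - k *s x \<in> F" using z F' by blast
    have "M *v (z + k *s x) - (z + k *s x) = (M *v z - z - k *s x) + k *s (M *v x)"
      by (simp add: vec.add vec.scale)
    also have "\<dots> \<in> F"
      using k M(2) by (intro vec.subspace_add vec.subspace_scale D(1))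
    finally have "z + k *s x \<in> F" by (rule D(4)[OF M(1)])
    then have "z - (- k) *s x \<in> F" by simp
    then show ?thesis using F' by blast
  qed
  have faithful: "M = 0" if "M \<in> S" "\<forall>z. M *v z \<in> vec.span (insert x F)" for M
    using x that unfolding bad_vectors_def by blast
  show ?thesis
    unfolding trivial_spectrum_mod_def
  proof (intro conjI ballI allI impI)
    fix M assume "M \<in> {M \<in> S. M *v x \<in> F}"
    then have M: "M \<in> S" "M *v x \<in> F" by simp_all
    show "M *v v \<in> vec.span (insert x F)" if "v \<in> vec.span (insert x F)" for v
      using stab M that .
    show "z \<in> vec.span (insert x F)" if "M *v z - z \<in> vec.span (insert x F)" for z
      using fixed M that .
    show "M = 0" if "\<forall>z. M *v z \<in> vec.span (insert x F)"
      using faithful M(1) that .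
  qed (fact sub vec.subspace_span)+
qed

text \<open>The span omits \<open>x\<close>: writing \<open>x\<close> as \<open>M *v x + f\<close>
  with \<open>f\<close> in \<open>F\<close> would make it a fixed class.\<close>

lemma dim_eval_le:
  fixes F :: "('a::field^'n) set" and S :: "('a^'n^'n) set"
  assumes S: "trivial_spectrum_mod F S" and xF: "x \<notin> F"
  shows "vec.dim (vec.span ((\<lambda>M. M *v x) ` S \<union> F)) \<le> CARD('n) - 1"
proof -
  note D = trivial_spectrum_modD[OF S]
  let ?T = "vec.span ((\<lambda>M. M *v x) ` S \<union> F)"
  have "x \<notin> ?T"
  proof
    assume "x \<in> ?T"
    moreover have "vec.span ((\<lambda>M. M *v x) ` S) = (\<lambda>M. M *v x) ` S"
      using subspace_eval[OF D(2)] by simp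
    moreover have "vec.span F = F" using D(1) by simp
    ultimately obtain M f where "M \<in> S" "f \<in> F" "x = M *v x + f"
      unfolding vec.span_Un by auto
    then have "M *v x - x = - f" by (metis add_diff_cancel_left diff_0_right add_0_right group_cancel.sub1 minus_diff_eq)
    then have "M *v x - x \<in> F" using \<open>f \<in> F\<close> D(1) by (simp add: vec.subspace_neg)
    then show False using D(4)[OF \<open>M \<in> S\<close>] xF by blast
  qed
  then have "?T \<subset> UNIV" by auto
  then have "vec.dim ?T < vec.dim (UNIV :: ('a^'n) set)"
    by (intro vec.dim_psubset) (simp only: vec.span_span vec.span_UNIV)
  then show ?thesis unfolding vec_dim_card by linarith
qed

text \<open>Induction on the codimension \<open>Suc m\<close> of \<open>F\<close>: for
  \<open>x\<close> outside \<open>F\<close> and not bad, passing to the matrices that send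
  \<open>x\<close> into \<open>F\<close> costs at most \<open>m\<close> dimensions, and
  \<open>x\<close> is absorbed into \<open>F\<close>.\<close>

lemma dim_trivial_spectrum_mod_le:
  fixes F :: "('a::field^'n) set" and S :: "('a^'n^'n) set"
  assumes "trivial_spectrum_mod F S"
  shows "mat_vs.dim S \<le> (CARD('n) - vec.dim F) choose 2"
  using assms
proof (induction "CARD('n) - vec.dim F" arbitrary: F S)
  case 0
  note D = trivial_spectrum_modD[OF "0.prems"]
  have "F = UNIV"
    using "0.hyps" by (intro subspace_full_dim D(1)) simp
  then have "S \<subseteq> {0}" using D(5) by blast
  then have "mat_vs.dim S = 0" by (simp only: mat_vs.dim_eq_0)
  then show ?case by linarith
next
  case (Suc m)
  note D = trivial_spectrum_modD[OF Suc.prems]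
  have "F \<noteq> UNIV" using Suc.hyps(2) vec_dim_card by (metis diff_self_eq_0 nat.simps(3))
  then have "vec.span (F \<union> bad_vectors F S) \<noteq> UNIV"
    by (rule bad_vectors_not_spanning[OF Suc.prems])
  then obtain x where "x \<notin> vec.span (F \<union> bad_vectors F S)" by auto
  then have x: "x \<notin> F" "x \<notin> bad_vectors F S"
    using vec.span_superset by blast+
  let ?F = "vec.span (insert x F)"
  have "x \<notin> vec.span F" using x(1) D(1) by (metis vec.span_eq_iff)
  then have dF: "vec.dim ?F = Suc (vec.dim F)"
    by (simp add: vec.dim_insert)
  have "mat_vs.dim {M \<in> S. M *v x \<in> F} \<le> (CARD('n) - vec.dim ?F) choose 2"
    using Suc.hyps(2) dF by (intro Suc.hyps(1) trivial_spectrum_mod_extend[OF Suc.prems x(2)]) simp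
  moreover have "mat_vs.dim S + vec.dim F
      = mat_vs.dim {M \<in> S. M *v x \<in> F} + vec.dim (vec.span ((\<lambda>M. M *v x) ` S \<union> F))"
    by (rule mat_vec.dim_preimage_sum[OF linear_eval D(2,1)])
  moreover have "vec.dim (vec.span ((\<lambda>M. M *v x) ` S \<union> F)) \<le> CARD('n) - 1"
    by (rule dim_eval_le[OF Suc.prems x(1)])
  moreover have "CARD('n) - vec.dim ?F = m" "CARD('n) - vec.dim F = Suc m"
    using dF Suc.hyps(2) by simp_all
  ultimately show ?case by (simp add: Suc_choose_two del: vec.dim_span)
qed

text \<open>When the bound is attained, both estimates in its induction step must be equalities, for
  every admissible \<open>x\<close>.\<close>

lemma dim_eval_eq:
  fixes F :: "('a::field^'n) set" and S :: "('a^'n^'n) set"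
  assumes S: "trivial_spectrum_mod F S" and max: "mat_vs.dim S = (CARD('n) - vec.dim F) choose 2"
    and x: "x \<notin> F" "x \<notin> bad_vectors F S"
  shows "vec.dim (vec.span ((\<lambda>M. M *v x) ` S \<union> F)) = CARD('n) - 1"
    and "mat_vs.dim {M \<in> S. M *v x \<in> F} = (CARD('n) - vec.dim F - 1) choose 2"
proof -
  note D = trivial_spectrum_modD[OF S]
  let ?F = "vec.span (insert x F)"
  have "x \<notin> vec.span F" using x(1) D(1) by (metis vec.span_eq_iff)
  then have dF: "vec.dim ?F = Suc (vec.dim F)"
    by (simp add: vec.dim_insert)
  have "vec.dim ?F \<le> CARD('n)" 
    using vec.dim_subset[of ?F UNIV] unfolding vec_dim_card by blast
  then obtain m where m: "CARD('n) - vec.dim F = Suc m" using dF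
    by (metis Suc_diff_Suc Suc_le_eq)
  have 1: "mat_vs.dim {M \<in> S. M *v x \<in> F} \<le> (CARD('n) - vec.dim ?F) choose 2"
    by (intro dim_trivial_spectrum_mod_le trivial_spectrum_mod_extend[OF S x(2)])
  have 2: "mat_vs.dim S + vec.dim F
      = mat_vs.dim {M \<in> S. M *v x \<in> F} + vec.dim (vec.span ((\<lambda>M. M *v x) ` S \<union> F))"
    by (rule mat_vec.dim_preimage_sum[OF linear_eval D(2,1)])
  have 3: "vec.dim (vec.span ((\<lambda>M. M *v x) ` S \<union> F)) \<le> CARD('n) - 1"
    by (rule dim_eval_le[OF S x(1)])
  have "CARD('n) - vec.dim ?F = m" using dF m by simp
  then show "vec.dim (vec.span ((\<lambda>M. M *v x) ` S \<union> F)) = CARD('n) - 1"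
    and "mat_vs.dim {M \<in> S. M *v x \<in> F} = (CARD('n) - vec.dim F - 1) choose 2"
    using 1 2 3 m max by (simp_all add: Suc_choose_two del: vec.dim_span)
qed

section \<open>Maximal spaces\<close>

locale maximal_space =
  fixes V :: "('a::field^'n^'n) set"
  assumes three: "\<exists>a b c :: 'a. a \<noteq> b \<and> a \<noteq> c \<and> b \<noteq> c"
    and subspace_V: "mat_vs.subspace V"
    and no_fixed_vector: "M \<in> V \<Longrightarrow> M *v x = x \<Longrightarrow> x = 0"
    and dim_V: "mat_vs.dim V = CARD('n) choose 2"
begin

definition orbit :: "'a^'n \<Rightarrow> ('a^'n) set" where
  "orbit x = (\<lambda>M. M *v x) ` V"

definition annihilator :: "'a^'n \<Rightarrow> ('a^'n^'n) set" where
  "annihilator x = {M \<in> V. M *v x = 0}"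

definition annihilator_orbit :: "'a^'n \<Rightarrow> 'a^'n \<Rightarrow> ('a^'n) set" where
  "annihilator_orbit x y = (\<lambda>M. M *v y) ` annihilator x"

definition bad_span :: "('a^'n) set" where
  "bad_span = vec.span (bad_vectors {0} V)"

lemma orbitI: "M \<in> V \<Longrightarrow> M *v x \<in> orbit x"
  by (simp add: orbit_def)

lemma subspace_orbit: "vec.subspace (orbit x)"
  unfolding orbit_def using subspace_V by (rule subspace_eval)

lemma subspace_annihilator: "mat_vs.subspace (annihilator x)"
  unfolding annihilator_def using subspace_V mat_vec.linear_0[OF linear_eval[of x]]
  by (simp add: mat_vs.subspace_def matrix_vector_mult_add_rdistrib)

lemma subspace_annihilator_orbit: "vec.subspace (annihilator_orbit x y)"
  unfolding annihilator_orbit_def using subspace_annihilator by (rule subspace_eval)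

lemma subspace_bad_span: "vec.subspace bad_span"
  by (simp add: bad_span_def)

lemma not_in_orbit: "x \<noteq> 0 \<Longrightarrow> x \<notin> orbit x"
  unfolding orbit_def using no_fixed_vector by force

lemma dim_orbit_le:
  assumes "x \<noteq> 0" shows "vec.dim (orbit x) \<le> CARD('n) - 1"
proof -
  have "\<not> CARD('n) \<le> vec.dim (orbit x)"
    using subspace_full_dim[OF subspace_orbit] not_in_orbit[OF assms] by blast
  then show ?thesis by linarith
qed

lemma annihilator_orbit_subset: "annihilator_orbit x y \<subseteq> orbit y"
  by (auto simp: annihilator_orbit_def orbit_def annihilator_def)

lemma trivial_spectrum_mod_V: "trivial_spectrum_mod {0} V"
  unfolding trivial_spectrum_mod_def
proof (intro conjI ballI allI impI)
  fix M assume M: "M \<in> V"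
  show "M *v v \<in> {0}" if "v \<in> {0}" for v using that by simp
  show "z \<in> {0}" if "M *v z - z \<in> {0}" for z using no_fixed_vector[OF M, of z] that by simp
  show "M = 0" if "\<forall>z. M *v z \<in> {0}"
    using that by (metis matrix_eq matrix_vector_mult_0 singletonD)
qed (simp_all add: subspace_V)

lemma bad_span_proper: "bad_span \<noteq> UNIV"
proof -
  have "axis undefined 1 \<noteq> (0 :: 'a^'n)" by (simp add: axis_eq_0_iff)
  then have "{0} \<noteq> (UNIV :: ('a^'n) set)" by blast
  then have "vec.span ({0} \<union> bad_vectors {0} V) \<noteq> UNIV"
    by (rule bad_vectors_not_spanning[OF trivial_spectrum_mod_V])
  then show ?thesis by (simp add: bad_span_def vec.span_insert_0)
qed

lemma notin_bad_span: "x \<notin> bad_span \<Longrightarrow> x \<noteq> 0 \<and> x \<notin> bad_vectors {0} V"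
  unfolding bad_span_def using vec.span_base vec.span_zero by blast

lemma dim_orbit:
  assumes "x \<notin> bad_span" shows "vec.dim (orbit x) = CARD('n) - 1"
proof -
  have "vec.dim (vec.span (orbit x \<union> {0})) = CARD('n) - 1"
    unfolding orbit_def using notin_bad_span[OF assms] dim_V
    by (intro dim_eval_eq(1)[OF trivial_spectrum_mod_V]) simp_all
  then show ?thesis by (simp add: vec.span_insert_0)
qed

lemma dim_annihilator:
  assumes "x \<notin> bad_span" shows "mat_vs.dim (annihilator x) = (CARD('n) - 1) choose 2"
proof -
  have "mat_vs.dim {M \<in> V. M *v x \<in> {0}} = (CARD('n) - vec.dim ({0} :: ('a^'n) set) - 1) choose 2"
    using notin_bad_span[OF assms] dim_V
    by (intro dim_eval_eq(2)[OF trivial_spectrum_mod_V]) simp_all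
  then show ?thesis by (simp add: annihilator_def)
qed

lemma trivial_spectrum_mod_annihilator:
  assumes "x \<notin> bad_span" shows "trivial_spectrum_mod (vec.span {x}) (annihilator x)"
proof -
  have "trivial_spectrum_mod (vec.span (insert x {0})) {M \<in> V. M *v x \<in> {0}}"
    using notin_bad_span[OF assms] by (intro trivial_spectrum_mod_extend[OF trivial_spectrum_mod_V]) simp_all
  then show ?thesis by (simp add: annihilator_def insert_commute[of x] vec.span_insert_0)
qed

text \<open>The annihilator of \<open>x\<close> is itself of maximal dimension modulo the line of
  \<open>x\<close>, so its values at \<open>y\<close> together with \<open>x\<close> span a
  hyperplane; leaving out \<open>x\<close> loses at most one dimension.\<close>

lemma dim_annihilator_orbit_ge:
  assumes x: "x \<notin> bad_span" and y: "y \<notin> vec.span {x}" "y \<notin> bad_vectors (vec.span {x}) (annihilator x)"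
  shows "CARD('n) - 2 \<le> vec.dim (annihilator_orbit x y)"
proof -
  have "vec.dim (vec.span {x}) = 1" using notin_bad_span[OF x] by simp
  then have "vec.dim (vec.span (annihilator_orbit x y \<union> vec.span {x})) = CARD('n) - 1"
    unfolding annihilator_orbit_def using y dim_annihilator[OF x]
    by (intro dim_eval_eq(1)[OF trivial_spectrum_mod_annihilator[OF x]]) simp_all
  moreover have "vec.span (annihilator_orbit x y \<union> vec.span {x}) = vec.span (insert x (annihilator_orbit x y))"
  proof -
    have "vec.span (annihilator_orbit x y \<union> vec.span {x}) = vec.span (annihilator_orbit x y \<union> {x})"
      by (simp only: vec.span_Un vec.span_span)
    then show ?thesis by simp
  qed
  ultimately show ?thesis by (simp add: vec.dim_insert split: if_splits)
qed

text \<open>By rank-nullity both annihilators have the same dimension, and both evaluations have as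
  kernel the matrices killing \<open>x\<close> and \<open>y\<close>.\<close>

lemma dim_annihilator_orbit_commute:
  assumes "vec.dim (orbit x) = vec.dim (orbit y)"
  shows "vec.dim (annihilator_orbit x y) = vec.dim (annihilator_orbit y x)"
proof -
  have 1: "mat_vs.dim V = vec.dim (orbit z) + mat_vs.dim (annihilator z)" for z
    unfolding orbit_def annihilator_def
    by (rule mat_vec.dim_image_kernel[OF linear_eval subspace_V])
  have 2: "mat_vs.dim (annihilator z)
      = vec.dim (annihilator_orbit z w) + mat_vs.dim {M \<in> annihilator z. M *v w = 0}" for z w
    unfolding annihilator_orbit_def by (rule mat_vec.dim_image_kernel[OF linear_eval subspace_annihilator])
  have 3: "{M \<in> annihilator x. M *v y = 0} = {M \<in> annihilator y. M *v x = 0}"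
    by (auto simp: annihilator_def)
  show ?thesis using 1[of x] 1[of y] 2[of x y] 2[of y x] 3 assms by simp
qed

lemma annihilator_orbit_subset_orbit:
  assumes x: "vec.dim (orbit x) = CARD('n) - 1" and y: "vec.dim (orbit y) = CARD('n) - 1"
    and yx: "y \<notin> vec.span {x}" and xy: "CARD('n) - 2 \<le> vec.dim (annihilator_orbit x y)"
  shows "annihilator_orbit x y \<subseteq> orbit x"
proof (cases "annihilator_orbit x y = annihilator_orbit y x")
  case True
  then show ?thesis using annihilator_orbit_subset[of y x] by simp
next
  case False
  obtain s :: 'a where s: "s \<noteq> 0" "s \<noteq> 1" using three by metis
  define S where "S = {a + b |a b. a \<in> annihilator_orbit x y \<and> b \<in> annihilator_orbit y x}"
  have S: "vec.subspace S"
    unfolding S_def using subspace_annihilator_orbit by (rule vec.subspace_sums) (rule subspace_annihilator_orbit)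
  have xyS: "annihilator_orbit x y \<subseteq> S" "annihilator_orbit y x \<subseteq> S"
    unfolding S_def using vec.subspace_0[OF subspace_annihilator_orbit] by force+
  have "\<not> S \<subseteq> annihilator_orbit x y"
  proof
    assume "S \<subseteq> annihilator_orbit x y"
    then have "annihilator_orbit y x = annihilator_orbit x y"
      using xyS(2) dim_annihilator_orbit_commute[of x y] x y subspace_annihilator_orbit
      by (intro vec.subspace_dim_equal) auto
    then show False using False by simp
  qed
  then have "vec.dim (annihilator_orbit x y) < vec.dim S"
    using xyS(1) S subspace_annihilator_orbit
    by (metis dual_order.refl not_le_imp_less vec.subspace_dim_equal)
  then have dS: "CARD('n) - 1 \<le> vec.dim S" using xy by linarith
  have nz: "x + t *s y \<noteq> 0" if t: "t \<noteq> 0" for t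
  proof
    assume "x + t *s y = 0"
    then have "y = (- inverse t) *s x"
      using t by (simp add: vec_eq_iff field_simps eq_neg_iff_add_eq_0 add.commute)
    then show False using yx by (metis insertI1 vec.span_base vec.span_scale)
  qed
  have eq: "S = orbit (x + t *s y)" if t: "t \<noteq> 0" for t
  proof -
    have sub: "S \<subseteq> orbit (x + t *s y)"
    proof
      fix v assume "v \<in> S"
      then obtain M N where MN: "M \<in> V" "M *v x = 0" "N \<in> V" "N *v y = 0" "v = M *v y + N *v x"
        by (auto simp: S_def annihilator_orbit_def annihilator_def)
      \<comment> \<open>\<open>M\<close> kills \<open>x\<close> and \<open>N\<close> kills
        \<open>y\<close>, so scaling \<open>M\<close> by \<open>inverse t\<close> makes the mixed
        terms vanish and leaves \<open>M *v y + N *v x\<close>.\<close>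
      have "v = (mat_scale (inverse t) M + N) *v (x + t *s y)"
        using MN t by (simp add: matrix_vector_mult_add_rdistrib vec.add vec.scale vector_smult_assoc)
      moreover have "mat_scale (inverse t) M + N \<in> V"
        using MN subspace_V by (intro mat_vs.subspace_add mat_vs.subspace_scale)
      ultimately show "v \<in> orbit (x + t *s y)" using orbitI by simp
    qed
    show ?thesis
      using sub S subspace_orbit dS dim_orbit_le[OF nz[OF t]] by (intro vec.subspace_dim_equal) auto
  qed
  have "orbit x \<subseteq> S"
  proof
    fix v assume "v \<in> orbit x"
    then obtain M where M: "M \<in> V" "v = M *v x" by (auto simp: orbit_def)
    have 1: "M *v (x + 1 *s y) \<in> S" using eq[of 1] orbitI[OF M(1)] by simp
    have 2: "M *v (x + s *s y) \<in> S" using eq[of s] orbitI[OF M(1)] s by simp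
    \<comment> \<open>Eliminating \<open>M *v y\<close> from the values at \<open>x + y\<close> and
      \<open>x + s *s y\<close> isolates \<open>M *v x\<close>; this needs a scalar \<open>s\<close>
      other than 0 and 1.\<close>
    have "inverse (s - 1) *s (s *s (M *v (x + 1 *s y)) - M *v (x + s *s y)) \<in> S"
      using 1 2 S by (intro vec.subspace_scale vec.subspace_diff)
    moreover have "s *s (M *v (x + 1 *s y)) - M *v (x + s *s y) = (s - 1) *s (M *v x)"
      by (simp add: vec.add vec.scale vec_eq_iff algebra_simps)
    ultimately show "v \<in> S" using s(2) M(2) by (simp only: not_False_eq_True inverse_smult right_minus_eq)
  qed
  moreover have "vec.dim S \<le> CARD('n) - 1"
    using eq[of 1] dim_orbit_le[OF nz[of 1]] by simp
  ultimately have "orbit x = S"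
    using x S subspace_orbit by (intro vec.subspace_dim_equal) auto
  then show ?thesis using xyS by simp
qed

text \<open>The condition on \<open>z\<close> is linear, so it is enough to have it for
  \<open>y\<close> outside two proper subspaces: \<open>bad_span\<close>, and the span of
  \<open>x\<close> with the bad vectors relative to \<open>x\<close>. The latter is proper only if
  \<open>x\<close> does not span everything, which accounts for the first case.\<close>

lemma annihilator_image_subset_orbit:
  assumes x: "x \<notin> bad_span" and M: "M \<in> annihilator x"
  shows "M *v z \<in> orbit x"
proof (cases "vec.span {x} = UNIV")
  case True
  then have "z \<in> vec.span {x}" by simp
  then obtain k where "z = k *s x" unfolding vec.span_singleton by blast
  then have "M *v z = 0" using M by (simp add: vec.scale annihilator_def)
  then show ?thesis using vec.subspace_0[OF subspace_orbit] by simp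
next
  case False
  let ?N = "{y. \<forall>M\<in>annihilator x. M *v y \<in> orbit x}"
  let ?bad = "bad_vectors (vec.span {x}) (annihilator x)"
  have "?N = UNIV"
  proof (rule outside_two_subspaces_spanning[OF three subspace_bad_span bad_span_proper])
    show "vec.subspace (vec.span (vec.span {x} \<union> ?bad))" by simp
    show "vec.span (vec.span {x} \<union> ?bad) \<noteq> UNIV"
      using False by (rule bad_vectors_not_spanning[OF trivial_spectrum_mod_annihilator[OF x]])
    show "vec.subspace ?N"
      using subspace_orbit[of x] by (simp add: vec.subspace_def vec.add vec.scale)
    fix y assume y: "y \<notin> bad_span" and "y \<notin> vec.span (vec.span {x} \<union> ?bad)"
    then have y': "y \<notin> vec.span {x}" "y \<notin> ?bad"
      using vec.span_superset[of "vec.span {x} \<union> ?bad"] by blast+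
    have "annihilator_orbit x y \<subseteq> orbit x"
      using dim_orbit[OF x] dim_orbit[OF y] y'(1) dim_annihilator_orbit_ge[OF x y']
      by (rule annihilator_orbit_subset_orbit)
    then show "y \<in> ?N" by (auto simp: annihilator_orbit_def)
  qed
  then show ?thesis using M by blast
qed

text \<open>A nonzero matrix with range in the line of \<open>b\<close> has a nonzero value in
  \<open>orbit x\<close>: its value at \<open>x\<close>, or any nonzero value if it annihilates
  \<open>x\<close>. That value is a multiple of \<open>b\<close>.\<close>

lemma bad_span_subset_orbit:
  assumes x: "x \<notin> bad_span" shows "bad_span \<subseteq> orbit x"
  unfolding bad_span_def
proof (rule vec.span_minimal[OF _ subspace_orbit], rule subsetI)
  fix b assume "b \<in> bad_vectors {0} V"
  then obtain M where M: "M \<in> V" "M \<noteq> 0" "\<And>z. M *v z \<in> vec.span (insert b {0})"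
    unfolding bad_vectors_def by blast
  obtain z where z: "M *v z \<noteq> 0" "M *v z \<in> orbit x"
  proof (cases "M *v x = 0")
    case True
    obtain z where "M *v z \<noteq> 0" using M(2) by (metis matrix_eq matrix_vector_mult_0)
    then show thesis
      using that annihilator_image_subset_orbit[OF x, of M z] M(1) True by (simp add: annihilator_def)
  next
    case False
    then show thesis using that[of x] orbitI[OF M(1), of x] by blast
  qed
  have "M *v z \<in> vec.span {b}" using M(3)[of z] by (simp add: insert_commute[of b] vec.span_insert_0)
  then obtain k where k: "M *v z = k *s b" unfolding vec.span_singleton by blast
  then have "k \<noteq> 0" using z(1) by auto
  then have "b = inverse k *s (M *v z)" using k by (simp only: not_False_eq_True inverse_smult)
  then show "b \<in> orbit x" using vec.subspace_scale[OF subspace_orbit z(2)] by simp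
qed

section \<open>Pairs of vectors independent modulo \<open>bad_span\<close>\<close>

definition indep :: "'a^'n \<Rightarrow> 'a^'n \<Rightarrow> bool" where
  "indep x y \<longleftrightarrow> x \<notin> bad_span \<and> y \<notin> vec.span (insert x bad_span)"

lemma span_insert_bad_span: "y \<in> vec.span (insert x bad_span) \<longleftrightarrow> (\<exists>k. y - k *s x \<in> bad_span)"
proof -
  have "vec.span bad_span = bad_span" using subspace_bad_span by simp
  then show ?thesis using vec.span_breakdown_eq[of y x bad_span] by (simp only:)
qed

lemma indepD: "indep x y \<Longrightarrow> x \<notin> bad_span" "indep x y \<Longrightarrow> y \<notin> bad_span" "indep x y \<Longrightarrow> y - k *s x \<notin> bad_span"
  unfolding indep_def span_insert_bad_span by (auto dest: spec[of _ 0])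

lemma indep_commute: "indep x y \<Longrightarrow> indep y x"
proof -
  assume xy: "indep x y"
  have "x \<notin> vec.span (insert y bad_span)"
  proof
    assume "x \<in> vec.span (insert y bad_span)"
    moreover have "x \<notin> vec.span bad_span" using indepD(1)[OF xy] subspace_bad_span by (metis vec.span_eq_iff)
    ultimately have "y \<in> vec.span (insert x bad_span)" by (rule vec.in_span_insert)
    then show False using xy by (simp add: indep_def)
  qed
  then show ?thesis using indepD(2)[OF xy] by (simp add: indep_def)
qed

text \<open>An offending matrix would have its range in the plane of \<open>x\<close> and
  \<open>y\<close>, but also in \<open>orbit x\<close>, which omits \<open>x\<close>. The range is
  then a line, so its generator lies in \<open>bad_span\<close> and relates \<open>x\<close> and
  \<open>y\<close> modulo \<open>bad_span\<close>.\<close>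

lemma indep_not_bad:
  assumes xy: "indep x y"
  shows "y \<notin> bad_vectors (vec.span {x}) (annihilator x)"
proof
  assume "y \<in> bad_vectors (vec.span {x}) (annihilator x)"
  then obtain M where M: "M \<in> annihilator x" "M \<noteq> 0"
      "\<And>z. M *v z \<in> vec.span (insert y (vec.span {x}))"
    unfolding bad_vectors_def by blast
  note x = indepD(1)[OF xy]
  have "\<exists>k l. M *v z = k *s y + l *s x" for z
  proof -
    obtain k where "M *v z - k *s y \<in> vec.span {x}"
      using M(3)[of z] unfolding vec.span_breakdown_eq vec.span_span by blast
    then obtain l where "M *v z - k *s y = l *s x" unfolding vec.span_singleton by blast
    then have "M *v z = k *s y + l *s x" by (metis diff_add_cancel add.commute)
    then show ?thesis by blast
  qed
  then obtain k l where kl: "\<And>z. M *v z = k z *s y + l z *s x" by metis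
  have x0: "a = 0" if "a *s x \<in> orbit x" for a
  proof (rule ccontr)
    assume "a \<noteq> 0"
    then have "x \<in> orbit x"
      using vec.subspace_scale[OF subspace_orbit that, of "inverse a"] by (simp only: not_False_eq_True inverse_smult)
    then show False using not_in_orbit notin_bad_span[OF x] by blast
  qed
  have MV: "M *v z \<in> orbit x" for z by (rule annihilator_image_subset_orbit[OF x M(1)])
  obtain z where z: "M *v z \<noteq> 0" using M(2) by (metis matrix_eq matrix_vector_mult_0)
  have kz: "k z \<noteq> 0"
  proof
    assume "k z = 0"
    then have eq: "M *v z = l z *s x" using kl[of z] by simp
    then have "l z = 0" using MV[of z] x0 by simp
    then show False using z eq by simp
  qed
  let ?b = "M *v z"
  have "M *v w \<in> vec.span (insert ?b {0})" for w
  proof -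
    have eq: "M *v w - (k w * inverse (k z)) *s ?b = (l w - k w * inverse (k z) * l z) *s x"
      unfolding kl[of w] kl[of z] using kz by (simp add: vec_eq_iff field_simps)
    have "M *v w - (k w * inverse (k z)) *s ?b \<in> orbit x"
      using MV by (intro vec.subspace_diff vec.subspace_scale subspace_orbit)
    then have "l w - k w * inverse (k z) * l z = 0" using x0 unfolding eq by blast
    then have "M *v w - (k w * inverse (k z)) *s ?b = 0" unfolding eq by simp
    then have "M *v w = (k w * inverse (k z)) *s ?b" by simp
    then show ?thesis by (metis insertI1 vec.span_base vec.span_scale)
  qed
  then have "?b \<in> bad_vectors {0} V"
    using M(1,2) unfolding bad_vectors_def annihilator_def by blast
  then have "?b \<in> bad_span" unfolding bad_span_def by (rule vec.span_base)
  then have "inverse (k z) *s ?b \<in> bad_span" using vec.subspace_scale[OF subspace_bad_span] by blast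
  moreover have "inverse (k z) *s ?b = y - (- inverse (k z) * l z) *s x"
    unfolding kl[of z] using kz by (simp add: vec_eq_iff field_simps)
  ultimately show False using indepD(3)[OF xy] by metis
qed

lemma orbit_complement:
  assumes x: "x \<notin> bad_span" shows "\<exists>k. y - k *s x \<in> orbit x"
proof -
  have sp: "vec.span (orbit x) = orbit x" using subspace_orbit by simp
  have "x \<notin> vec.span (orbit x)" unfolding sp using not_in_orbit notin_bad_span[OF x] by blast
  then have "vec.dim (insert x (orbit x)) = Suc (CARD('n) - 1)"
    by (simp add: vec.dim_insert dim_orbit[OF x])
  then have "vec.span (insert x (orbit x)) = UNIV"
    by (intro subspace_full_dim) simp_all
  then show ?thesis using vec.span_breakdown_eq[of y x "orbit x"] unfolding sp by blast
qed

text \<open>If the two hyperplanes agree, some \<open>y - k *s x\<close> lies in them. Its orbit is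
  contained in the same hyperplane and has the same dimension, so the vector would lie in its own
  orbit.\<close>

lemma indep_orbit_not_subset:
  assumes xy: "indep x y" shows "\<not> orbit x \<subseteq> orbit y"
proof
  note x = indepD(1)[OF xy] and y = indepD(2)[OF xy]
  assume "orbit x \<subseteq> orbit y"
  then have eq: "orbit x = orbit y"
    using dim_orbit[OF x] dim_orbit[OF y] subspace_orbit by (intro vec.subspace_dim_equal) auto
  obtain k where k: "y - k *s x \<in> orbit x" using orbit_complement[OF x] by blast
  let ?w = "y - k *s x"
  have w: "?w \<notin> bad_span" by (rule indepD(3)[OF xy])
  have "orbit ?w \<subseteq> orbit x"
  proof
    fix v assume "v \<in> orbit ?w"
    then obtain M where M: "M \<in> V" "v = M *v y - k *s (M *v x)"
      by (auto simp: orbit_def vec.diff vec.scale)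
    show "v \<in> orbit x"
      unfolding M(2) using orbitI[OF M(1)] eq
      by (intro vec.subspace_diff vec.subspace_scale subspace_orbit) auto
  qed
  then have "orbit ?w = orbit x"
    using dim_orbit[OF x] dim_orbit[OF w] subspace_orbit by (intro vec.subspace_dim_equal) auto
  then show False using k not_in_orbit[of ?w] notin_bad_span[OF w] by auto
qed

text \<open>Two distinct hyperplanes meet in dimension at most \<open>CARD('n) - 2\<close>, which
  \<open>annihilator_orbit x y\<close> already reaches inside both.\<close>

lemma indep_annihilator_orbit:
  assumes xy: "indep x y" shows "annihilator_orbit x y = orbit x \<inter> orbit y"
proof (rule vec.subspace_dim_equal)
  note x = indepD(1)[OF xy] and y = indepD(2)[OF xy]
  have yx: "y \<notin> vec.span {x}"
    using indepD(3)[OF xy] vec.subspace_0[OF subspace_bad_span] unfolding vec.span_singleton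
    by (metis diff_self imageE)
  have ge: "CARD('n) - 2 \<le> vec.dim (annihilator_orbit x y)"
    by (rule dim_annihilator_orbit_ge[OF x yx indep_not_bad[OF xy]])
  show "vec.subspace (annihilator_orbit x y)" by (rule subspace_annihilator_orbit)
  show "vec.subspace (orbit x \<inter> orbit y)" by (intro vec.subspace_inter subspace_orbit)
  show "annihilator_orbit x y \<subseteq> orbit x \<inter> orbit y"
    using annihilator_orbit_subset_orbit[OF dim_orbit[OF x] dim_orbit[OF y] yx ge] annihilator_orbit_subset by blast
  have "orbit x \<inter> orbit y \<subset> orbit x" using indep_orbit_not_subset[OF xy] by blast
  then have "vec.dim (orbit x \<inter> orbit y) < vec.dim (orbit x)"
    by (intro vec.dim_psubset) (metis subspace_orbit vec.span_eq_iff vec.subspace_inter)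
  then show "vec.dim (annihilator_orbit x y) \<ge> vec.dim (orbit x \<inter> orbit y)"
    using ge dim_orbit[OF x] by linarith
qed

text \<open>For \<open>x\<close> outside \<open>bad_span\<close> the choice is determined up to a
  nonzero scalar only; the scalars are adjusted when the rows of the multiplier are built.\<close>

definition normal :: "'a^'n \<Rightarrow> 'a^'n" where
  "normal x = (SOME u. \<forall>v. scalar_product u v = 0 \<longleftrightarrow> v \<in> orbit x)"

lemma normal_eq_0_iff:
  assumes x: "x \<notin> bad_span" shows "scalar_product (normal x) v = 0 \<longleftrightarrow> v \<in> orbit x"
proof -
  have nx: "x \<notin> orbit x" using not_in_orbit notin_bad_span[OF x] by blast
  obtain u where u: "\<And>h. h \<in> orbit x \<Longrightarrow> scalar_product u h = 0" "scalar_product u x = 1"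
    using exists_separating_functional[OF subspace_orbit nx] by blast
  have "v \<in> orbit x" if v: "scalar_product u v = 0" for v
  proof -
    obtain k where k: "v - k *s x \<in> orbit x"
      using orbit_complement[OF x] by blast
    then have "k = 0" using u(1)[OF k] u(2) v by (simp add: scalar_product_linear)
    then show ?thesis using k by simp
  qed
  then have "\<forall>v. scalar_product u v = 0 \<longleftrightarrow> v \<in> orbit x" using u(1) by blast
  then have "\<forall>v. scalar_product (normal x) v = 0 \<longleftrightarrow> v \<in> orbit x" unfolding normal_def by (rule someI)
  then show ?thesis by blast
qed

text \<open>Both sides are linear functionals of \<open>M\<close>, and the kernel of the right one
  lies in that of the left one: if \<open>M *v x\<close> is in \<open>orbit y\<close>, it equals
  \<open>N *v x\<close> with \<open>N\<close> killing \<open>y\<close>, so \<open>M - N\<close>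
  annihilates \<open>x\<close> and sends \<open>y\<close> to \<open>M *v y\<close>, which is
  therefore in \<open>orbit x\<close>. The sign anticipates skew symmetry.\<close>

lemma indep_relation:
  assumes xy: "indep x y"
  shows "\<exists>c. c \<noteq> 0 \<and> (\<forall>M\<in>V. scalar_product (normal x) (M *v y) = - c * scalar_product (normal y) (M *v x))"
proof -
  note x = indepD(1)[OF xy] and y = indepD(2)[OF xy]
  have key: "scalar_product (normal x) (M *v y) = 0"
    if M: "M \<in> V" and 0: "scalar_product (normal y) (M *v x) = 0" for M
  proof -
    have "M *v x \<in> orbit y \<inter> orbit x" using 0 orbitI[OF M] normal_eq_0_iff[OF y] by blast
    then have "M *v x \<in> annihilator_orbit y x" using indep_annihilator_orbit[OF indep_commute[OF xy]] by simp
    then obtain N where N: "N \<in> V" "N *v y = 0" "M *v x = N *v x"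
      by (auto simp: annihilator_orbit_def annihilator_def)
    have "M - N \<in> annihilator x"
      using M N mat_vs.subspace_diff[OF subspace_V]
      by (simp add: annihilator_def matrix_vector_mult_diff_rdistrib)
    then have "(M - N) *v y \<in> orbit x" by (rule annihilator_image_subset_orbit[OF x])
    then have "M *v y \<in> orbit x" using N(2) by (simp add: matrix_vector_mult_diff_rdistrib)
    then show ?thesis using normal_eq_0_iff[OF x] by blast
  qed
  obtain v where "v \<in> orbit x" "v \<notin> orbit y" using indep_orbit_not_subset[OF xy] by blast
  then obtain N where N: "N \<in> V" "N *v x \<notin> orbit y" by (auto simp: orbit_def)
  let ?b = "scalar_product (normal y) (N *v x)"
  have b: "?b \<noteq> 0" using N(2) normal_eq_0_iff[OF y] by blast
  define c where "c = - (scalar_product (normal x) (N *v y) / ?b)"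
  have rel: "scalar_product (normal x) (M *v y) = - c * scalar_product (normal y) (M *v x)" if M: "M \<in> V" for M
  proof -
    let ?r = "scalar_product (normal y) (M *v x) / ?b"
    let ?M = "M - mat_scale ?r N"
    have "?M \<in> V" using M N(1) by (intro mat_vs.subspace_diff mat_vs.subspace_scale subspace_V)
    moreover have "scalar_product (normal y) (?M *v x) = 0"
      using b by (simp add: matrix_vector_mult_diff_rdistrib scalar_product_linear)
    ultimately have "scalar_product (normal x) (?M *v y) = 0" by (rule key)
    then show ?thesis
      by (simp add: matrix_vector_mult_diff_rdistrib scalar_product_linear c_def)
  qed
  have "c \<noteq> 0"
  proof
    assume "c = 0"
    then have "orbit y \<subseteq> orbit x"
      using rel normal_eq_0_iff[OF x] by (auto simp: orbit_def)
    then show False using indep_orbit_not_subset[OF indep_commute[OF xy]] by blast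
  qed
  then show ?thesis using rel by blast
qed

section \<open>Invariance of \<open>bad_span\<close> under \<open>V\<close>\<close>

lemma image_bad_span_subset_orbit:
  assumes x: "x \<notin> bad_span" and M: "M \<in> V" and b: "b \<in> bad_span"
  shows "M *v b \<in> orbit x"
proof (cases "vec.span (insert x bad_span) = UNIV")
  case True
  have xB: "x \<notin> vec.span bad_span" using x subspace_bad_span by (metis vec.span_eq_iff)
  have "vec.dim (vec.span (insert x bad_span)) = Suc (vec.dim bad_span)"
    using xB by (simp add: vec.dim_insert)
  then have dB: "Suc (vec.dim bad_span) = CARD('n)" unfolding True vec_dim_card by simp
  \<comment> \<open>Here \<open>bad_span\<close> is a hyperplane contained in each such orbit. Both
    \<open>x\<close> and \<open>x + b\<close> lie outside it.\<close>
  have eq: "bad_span = orbit y" if y: "y \<notin> bad_span" for y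
    using dB dim_orbit[OF y] bad_span_subset_orbit[OF y] subspace_bad_span subspace_orbit
    by (intro vec.subspace_dim_equal) auto
  have "x + b \<notin> bad_span"
    using x b vec.subspace_diff[OF subspace_bad_span, of "x + b" b] by auto
  then have "M *v (x + b) \<in> bad_span" using eq[of "x + b"] orbitI[OF M] by simp
  moreover have "M *v x \<in> bad_span" using eq[OF x] orbitI[OF M] by simp
  ultimately have "M *v (x + b) - M *v x \<in> bad_span" by (rule vec.subspace_diff[OF subspace_bad_span])
  then show ?thesis using eq[OF x] by (simp add: vec.add)
next
  case False
  \<comment> \<open>\<open>?g\<close> factors through \<open>orbit x / bad_span\<close>, which bounds the dimension of its image; hence the
    orthogonal \<open>?D\<close> of the image, which lies in \<open>span (insert x bad_span)\<close>, is all of it.\<close>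
  let ?g = "\<lambda>M. normal x v* M"
  let ?D = "{y. \<forall>s\<in>?g ` V. scalar_product s y = 0}"
  have g: "Vector_Spaces.linear mat_scale (*s) ?g"
    by unfold_locales
      (simp_all add: vec_eq_iff vector_matrix_mult_def mat_scale_def algebra_simps sum.distrib sum_distrib_left)
  \<comment> \<open>For \<open>y\<close> independent of \<open>x\<close>, \<open>orbit y\<close>
    contains \<open>bad_span\<close> and hence \<open>N *v x\<close>, so the relation between the
    normals makes the functional \<open>?g N\<close> vanish at \<open>y\<close>. Such
    \<open>y\<close> fill the complement of one proper subspace, which plays both roles in the
    spanning lemma.\<close>
  have g0: "?g N = 0" if N: "N \<in> V" "N *v x \<in> bad_span" for N
  proof -
    have "{y. scalar_product (?g N) y = 0} = UNIV"
    proof (rule outside_two_subspaces_spanning[OF three _ False _ False])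
      show "vec.subspace {y. scalar_product (?g N) y = 0}"
        by (simp add: vec.subspace_def scalar_product_linear)
      fix y assume "y \<notin> vec.span (insert x bad_span)"
      then have xy: "indep x y" using x by (simp add: indep_def)
      then obtain c where "scalar_product (normal x) (N *v y) = - c * scalar_product (normal y) (N *v x)"
        using indep_relation N(1) by blast
      moreover have "scalar_product (normal y) (N *v x) = 0"
        using N(2) bad_span_subset_orbit[OF indepD(2)[OF xy]] normal_eq_0_iff[OF indepD(2)[OF xy]] by blast
      ultimately show "y \<in> {y. scalar_product (?g N) y = 0}"
        by (simp add: scalar_product_matrix_vector)
    qed simp_all
    then have "?g N $ i = 0" for i using scalar_product_axis[of "?g N" i] by (metis UNIV_I mem_Collect_eq)
    then show ?thesis by (simp add: vec_eq_iff)
  qed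
  have "{N \<in> V. N *v x \<in> bad_span} \<subseteq> {N \<in> V. ?g N = 0}" using g0 by blast
  then have "mat_vs.dim {N \<in> V. N *v x \<in> bad_span} \<le> mat_vs.dim {N \<in> V. ?g N = 0}"
    by (rule mat_vs.dim_subset)
  moreover have "mat_vs.dim V = vec.dim (?g ` V) + mat_vs.dim {N \<in> V. ?g N = 0}"
    by (rule mat_vec.dim_image_kernel[OF g subspace_V])
  moreover have "mat_vs.dim V + vec.dim bad_span
      = mat_vs.dim {N \<in> V. N *v x \<in> bad_span} + vec.dim (vec.span (orbit x \<union> bad_span))"
    unfolding orbit_def by (rule mat_vec.dim_preimage_sum[OF linear_eval subspace_V subspace_bad_span])
  moreover have "vec.span (orbit x \<union> bad_span) = orbit x"
    using bad_span_subset_orbit[OF x] subspace_orbit[of x] by (simp add: sup_absorb1)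
  ultimately have "vec.dim (?g ` V) + vec.dim bad_span \<le> CARD('n) - 1"
    using dim_orbit[OF x] by simp
  moreover have "CARD('n) \<le> vec.dim ?D + vec.dim (?g ` V)" by (rule dim_orthogonal)
  moreover have "CARD('n) > 0" by simp
  ultimately have dD: "Suc (vec.dim bad_span) \<le> vec.dim ?D" by linarith
  have Dx: "N *v y \<in> orbit x" if "y \<in> ?D" "N \<in> V" for y N
  proof -
    have "scalar_product (normal x) (N *v y) = 0" using that by (simp add: scalar_product_matrix_vector)
    then show ?thesis using normal_eq_0_iff[OF x] by blast
  qed
  have "?D \<subseteq> vec.span (insert x bad_span)"
  proof (rule subsetI, rule ccontr)
    fix y assume y: "y \<in> ?D" and "y \<notin> vec.span (insert x bad_span)"
    then have xy: "indep x y" using x by (simp add: indep_def)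
    have "orbit y \<subseteq> orbit x"
      unfolding orbit_def[of y] using Dx[OF y] by blast
    then show False using indep_orbit_not_subset[OF indep_commute[OF xy]] by blast
  qed
  moreover have "vec.dim (vec.span (insert x bad_span)) \<le> Suc (vec.dim bad_span)"
    by (simp add: vec.dim_insert)
  ultimately have "?D = vec.span (insert x bad_span)"
    using dD by (intro vec.subspace_dim_equal subspace_orthogonal vec.subspace_span order_trans[OF _ dD])
  then have "b \<in> ?D" using b by (simp add: vec.span_base)
  then show ?thesis using M by (rule Dx)
qed

text \<open>The preceding inclusion is applied with \<open>M *v b\<close> itself as the outside
  vector, which would then lie in its own orbit.\<close>

lemma bad_span_invariant:
  assumes "M \<in> V" "b \<in> bad_span" shows "M *v b \<in> bad_span"
proof (rule ccontr)
  assume nB: "M *v b \<notin> bad_span"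
  then have "M *v b \<in> orbit (M *v b)" using assms by (intro image_bad_span_subset_orbit)
  then show False using not_in_orbit notin_bad_span[OF nB] by blast
qed

end

section \<open>Irreducible maximal spaces\<close>

locale irreducible_maximal_space = maximal_space V
  for V :: "('a::field^'n^'n) set" +
  assumes irreducible: "irreducible_matrices V"
begin

lemma bad_span_eq_0: "bad_span = {0}"
  using irreducible subspace_bad_span bad_span_invariant bad_span_proper unfolding irreducible_matrices_def by blast

lemma notin_bad_span_iff: "x \<notin> bad_span \<longleftrightarrow> x \<noteq> 0"
  by (simp add: bad_span_eq_0)

lemma indep_iff: "indep x y \<longleftrightarrow> x \<noteq> 0 \<and> y \<notin> vec.span {x}"
  by (simp add: indep_def bad_span_eq_0 insert_commute[of x] vec.span_insert_0)

section \<open>The proportionality constants and their cocycle identity\<close>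

definition ratio :: "'a^'n \<Rightarrow> 'a^'n \<Rightarrow> 'a" where
  "ratio x y = (SOME c. c \<noteq> 0 \<and>
     (\<forall>M\<in>V. scalar_product (normal x) (M *v y) = - c * scalar_product (normal y) (M *v x)))"

lemma ratio:
  assumes "indep x y"
  shows "ratio x y \<noteq> 0"
    and "M \<in> V \<Longrightarrow> scalar_product (normal x) (M *v y) = - ratio x y * scalar_product (normal y) (M *v x)"
  using someI_ex[OF indep_relation[OF assms]] unfolding ratio_def by blast+

lemma normal_self: "x \<noteq> 0 \<Longrightarrow> M \<in> V \<Longrightarrow> scalar_product (normal x) (M *v x) = 0"
  using normal_eq_0_iff[of x] orbitI notin_bad_span_iff by blast

lemma indep_exists_nonzero:
  assumes "indep x y" obtains M where "M \<in> V" "scalar_product (normal y) (M *v x) \<noteq> 0"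
proof -
  obtain v where "v \<in> orbit x" "v \<notin> orbit y" using indep_orbit_not_subset[OF assms] by blast
  then obtain M where "M \<in> V" "M *v x \<notin> orbit y" by (auto simp: orbit_def)
  then show thesis using that normal_eq_0_iff[OF indepD(2)[OF assms]] by blast
qed

lemma ratio_commute:
  assumes xy: "indep x y" shows "ratio x y * ratio y x = 1"
proof -
  obtain M where M: "M \<in> V" and nz: "scalar_product (normal y) (M *v x) \<noteq> 0"
    using indep_exists_nonzero[OF xy] by blast
  have "scalar_product (normal y) (M *v x) = - ratio y x * (- ratio x y * scalar_product (normal y) (M *v x))"
    using ratio(2)[OF indep_commute[OF xy] M] ratio(2)[OF xy M] by simp
  then show ?thesis using nz by (simp add: mult.commute)
qed

text \<open>A vector orthogonal to \<open>normal y\<close> and \<open>normal z\<close> has the form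
  \<open>M *v z\<close> with \<open>M *v y = 0\<close>; it equals \<open>M *v (y + z)\<close> and is
  thus orthogonal to \<open>normal (y + z)\<close>. The relative coefficient comes from expanding
  \<open>scalar_product (normal (y + z)) (M *v (y + z)) = 0\<close>.\<close>

lemma normal_add:
  assumes yz: "indep y z" and nz: "y + z \<noteq> 0"
  obtains a where "normal (y + z) = a *s (normal y + ratio y z *s normal z)"
proof -
  note y = indepD(1)[OF yz] and z = indepD(2)[OF yz]
  have "normal (y + z) \<in> vec.span {normal y, normal z}"
  proof (rule ccontr)
    assume "normal (y + z) \<notin> vec.span {normal y, normal z}"
    then obtain v where v: "\<And>h. h \<in> vec.span {normal y, normal z} \<Longrightarrow> scalar_product v h = 0"
        "scalar_product v (normal (y + z)) = 1"
      using exists_separating_functional[OF vec.subspace_span] by metis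
    have "scalar_product (normal y) v = 0" "scalar_product (normal z) v = 0"
      using v(1) by (simp_all add: vec.span_base scalar_product_commute[of _ v])
    then have "v \<in> annihilator_orbit y z"
      using indep_annihilator_orbit[OF yz] normal_eq_0_iff[OF y] normal_eq_0_iff[OF z] by simp
    then obtain M where M: "M \<in> V" "M *v y = 0" "v = M *v z"
      by (auto simp: annihilator_orbit_def annihilator_def)
    then have "v = M *v (y + z)" by (simp add: vec.add)
    then have "scalar_product (normal (y + z)) v = 0" using normal_self[OF nz M(1)] by simp
    then show False using v(2) by (simp add: scalar_product_commute[of v])
  qed
  then obtain a where "normal (y + z) - a *s normal y \<in> vec.span {normal z}"
    using vec.span_breakdown_eq[of "normal (y + z)" "normal y" "{normal z}"] by blast
  then obtain b where "normal (y + z) - a *s normal y = b *s normal z" unfolding vec.span_singleton by blast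
  then have ab: "normal (y + z) = a *s normal y + b *s normal z" by (metis diff_add_cancel add.commute)
  obtain M where M: "M \<in> V" and nzM: "scalar_product (normal z) (M *v y) \<noteq> 0"
    using indep_exists_nonzero[OF yz] by blast
  have "y \<noteq> 0" "z \<noteq> 0" using y z notin_bad_span_iff by auto
  have "0 = scalar_product (normal (y + z)) (M *v (y + z))" using normal_self[OF nz M] by simp
  also have "\<dots> = a * scalar_product (normal y) (M *v z) + b * scalar_product (normal z) (M *v y)"
    unfolding ab using normal_self[OF \<open>y \<noteq> 0\<close> M] normal_self[OF \<open>z \<noteq> 0\<close> M]
    by (simp add: vec.add scalar_product_linear)
  also have "\<dots> = (b - a * ratio y z) * scalar_product (normal z) (M *v y)"
    using ratio(2)[OF yz M] by (simp add: algebra_simps)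
  finally have "b = a * ratio y z" using nzM by simp
  then have "normal (y + z) = a *s (normal y + ratio y z *s normal z)"
    using ab by (simp add: vec.scale_right_distrib vector_smult_assoc)
  then show thesis by (rule that)
qed

text \<open>The relation for \<open>x\<close> and \<open>y + z\<close> is compared with the sum of
  those for \<open>x, y\<close> and \<open>x, z\<close>. The hypothesis on \<open>x\<close> states
  linear independence of the three vectors, so that both resulting coefficients vanish.\<close>

lemma ratio_cocycle:
  assumes yz: "indep y z" and x: "\<And>a b. a \<noteq> 0 \<or> b \<noteq> 0 \<Longrightarrow> indep x (a *s y + b *s z)"
  shows "ratio x z = ratio x y * ratio y z"
proof -
  have xy: "indep x y" and xz: "indep x z" and xyz: "indep x (y + z)"
    using x[of 1 0] x[of 0 1] x[of 1 1] by simp_all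
  have "y + z \<noteq> 0" using indepD(2)[OF xyz] notin_bad_span_iff by blast
  then obtain a where a: "normal (y + z) = a *s (normal y + ratio y z *s normal z)"
    using normal_add[OF yz] by blast
  let ?C = "ratio x (y + z) * a"
  let ?A = "ratio x y - ?C" and ?D = "ratio x z - ?C * ratio y z"
  have AD: "?A * scalar_product (normal y) (M *v x) + ?D * scalar_product (normal z) (M *v x) = 0"
    if M: "M \<in> V" for M
  proof -
    have "- ratio x (y + z) * scalar_product (normal (y + z)) (M *v x)
        = scalar_product (normal x) (M *v y) + scalar_product (normal x) (M *v z)"
      using ratio(2)[OF xyz M] by (simp add: vec.add scalar_product_linear)
    then show ?thesis
      unfolding a ratio(2)[OF xy M] ratio(2)[OF xz M]
      by (simp add: scalar_product_linear algebra_simps)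
  qed
  \<comment> \<open>Dividing by the ratios turns the identity \<open>AD\<close> into orthogonality
    of \<open>normal x\<close> to \<open>M *v w\<close> for all \<open>M\<close> in
    \<open>V\<close>.\<close>
  define w where "w = (?A / ratio x y) *s y + (?D / ratio x z) *s z"
  have "orbit w \<subseteq> orbit x"
  proof
    fix v assume "v \<in> orbit w"
    then obtain M where M: "M \<in> V" "v = M *v w" by (auto simp: orbit_def)
    have "scalar_product (normal x) v
        = - (?A * scalar_product (normal y) (M *v x) + ?D * scalar_product (normal z) (M *v x))"
      unfolding M(2) w_def vec.add vec.scale scalar_product_linear
        ratio(2)[OF xy M(1)] ratio(2)[OF xz M(1)]
      using ratio(1)[OF xy] ratio(1)[OF xz] by simp
    then have "scalar_product (normal x) v = 0" using AD[OF M(1)] by simp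
    then show "v \<in> orbit x" using normal_eq_0_iff[OF indepD(1)[OF xy]] by blast
  qed
  then have "\<not> indep x w" using indep_orbit_not_subset indep_commute by blast
  then have "?A / ratio x y = 0 \<and> ?D / ratio x z = 0" unfolding w_def using x by blast
  then have "?A = 0" "?D = 0" using ratio(1)[OF xy] ratio(1)[OF xz] by simp_all
  then show ?thesis by simp
qed

lemma indep_axis: "i \<noteq> j \<Longrightarrow> indep (axis i 1) (axis j 1)"
proof -
  assume ij: "i \<noteq> j"
  have "axis j 1 \<noteq> k *s (axis i 1 :: 'a^'n)" for k
  proof
    assume "axis j 1 = k *s (axis i 1 :: 'a^'n)"
    then have "(axis j 1 :: 'a^'n) $ j = (k *s axis i 1) $ j" by simp
    then show False using ij by (simp add: axis_def)
  qed
  then show ?thesis by (auto simp: indep_iff vec.span_singleton axis_eq_0_iff)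
qed

lemma ratio_axis_cocycle:
  assumes "i \<noteq> j" "i \<noteq> k" "j \<noteq> k"
  shows "ratio (axis i 1) (axis k 1) = ratio (axis i 1) (axis j 1) * ratio (axis j 1) (axis k 1)"
proof (rule ratio_cocycle[OF indep_axis[OF assms(3)]])
  fix a b :: 'a assume ab: "a \<noteq> 0 \<or> b \<noteq> 0"
  let ?v = "a *s axis j 1 + b *s axis k 1 :: 'a^'n"
  have "?v \<noteq> c *s axis i 1" for c
  proof
    assume eq: "?v = c *s axis i 1"
    have "?v $ j = a" "?v $ k = b" using assms by (simp_all add: axis_def)
    moreover have "(c *s axis i 1 :: 'a^'n) $ j = 0" "(c *s axis i 1 :: 'a^'n) $ k = 0"
      using assms by (simp_all add: axis_def)
    ultimately show False using ab eq by simp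
  qed
  then show "indep (axis i 1) ?v" by (auto simp: indep_iff vec.span_singleton axis_eq_0_iff)
qed

lemma exists_alternating_multiplier:
  obtains G :: "'a^'n^'n" where "invertible G" "\<And>M. M \<in> V \<Longrightarrow> alternate (G ** M)"
proof -
  obtain i0 :: 'n where True by simp
  let ?e = "\<lambda>i. axis i 1 :: 'a^'n"
  define k where "k i = (if i = i0 then 1 else ratio (?e i0) (?e i))" for i
  define G where "G = (\<chi> i. k i *s normal (?e i))"
  have e0: "?e i \<noteq> 0" for i by (simp add: axis_eq_0_iff)
  have k0: "k i \<noteq> 0" for i using ratio(1)[OF indep_axis[of i0 i]] by (simp add: k_def)
  \<comment> \<open>If \<open>i\<close> is \<open>i0\<close> this is the definition of
    \<open>k\<close>, if \<open>j\<close> is \<open>i0\<close> it is \<open>ratio_commute\<close>,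
    and otherwise it is the cocycle identity. It turns the relations between normals into skew
    symmetry of \<open>G ** M\<close>.\<close>
  have kk: "k i * ratio (?e i) (?e j) = k j" if ij: "i \<noteq> j" for i j
    using ratio_commute[OF indep_axis[of i0 i]] ratio_axis_cocycle[of i0 i j] ij
    by (auto simp: k_def)
  have GM: "(G ** M) $ i $ j = k i * scalar_product (normal (?e i)) (M *v ?e j)" for M i j
  proof -
    have "(G ** M) $ i $ j = scalar_product (G $ i) (M *v ?e j)"
      by (simp add: scalar_product_def matrix_matrix_mult_def mult_axis_nth)
    then show ?thesis by (simp add: G_def scalar_product_linear)
  qed
  have alt: "alternate (G ** M)" if M: "M \<in> V" for M
    unfolding alternate_iff
  proof (intro conjI allI)
    fix i j
    show diag: "(G ** M) $ i $ i = 0" for i using normal_self[OF e0 M] by (simp add: GM)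
    show "(G ** M) $ i $ j = - (G ** M) $ j $ i"
    proof (cases "i = j")
      case False
      have "(G ** M) $ i $ j = - (k i * ratio (?e i) (?e j)) * scalar_product (normal (?e j)) (M *v ?e i)"
        using ratio(2)[OF indep_axis[OF False] M] by (simp add: GM)
      then show ?thesis unfolding kk[OF False] by (simp add: GM)
    qed (simp add: diag)
  qed
  \<comment> \<open>Skew symmetry transfers \<open>X v* G = 0\<close> to coordinate
    \<open>i0\<close> of \<open>G ** M\<close> applied to \<open>X\<close>. Hence
    \<open>orbit X\<close> lies in the orbit of \<open>axis i0 1\<close>, and \<open>X\<close> is a
    multiple of that vector; row \<open>i0\<close> of \<open>G\<close> would then be zero, though it
    is normal to a proper subspace.\<close>
  have "X = 0" if X: "X v* G = 0" for X
  proof (rule ccontr)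
    assume "X \<noteq> 0"
    then have XB: "X \<notin> bad_span" by (simp add: notin_bad_span_iff)
    have "orbit X \<subseteq> orbit (?e i0)"
    proof
      fix v assume "v \<in> orbit X"
      then obtain M where M: "M \<in> V" "v = M *v X" by (auto simp: orbit_def)
      have "scalar_product (?e i0) ((G ** M) *v X) = - scalar_product X ((G ** M) *v ?e i0)"
        by (rule alternate_skew[OF alt[OF M(1)]])
      also have "\<dots> = 0"
        using X by (simp add: scalar_product_matrix_vector scalar_product_linear
            flip: matrix_vector_mul_assoc)
      finally have "((G ** M) *v X) $ i0 = 0"
        by (simp add: scalar_product_commute[of "?e i0"] scalar_product_axis)
      then have "(G *v v) $ i0 = 0" using M(2) by (simp add: matrix_vector_mul_assoc)
      then have "scalar_product (G $ i0) v = 0"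
        by (simp add: matrix_vector_mult_def scalar_product_def)
      then have "scalar_product (normal (?e i0)) v = 0"
        using k0[of i0] by (simp add: G_def scalar_product_linear)
      then show "v \<in> orbit (?e i0)" using normal_eq_0_iff e0 notin_bad_span_iff by blast
    qed
    then have "\<not> indep (?e i0) X" using indep_orbit_not_subset indep_commute by blast
    then obtain c where c: "X = c *s ?e i0" using e0 unfolding indep_iff vec.span_singleton by blast
    have "c \<noteq> 0" using c \<open>X \<noteq> 0\<close> by auto
    have "X v* G = c *s (k i0 *s normal (?e i0))"
      unfolding c by (simp add: vec_eq_iff vector_matrix_mult_def G_def axis_def if_distrib
          if_distribR cong: if_cong)
    then have "normal (?e i0) = 0" using X \<open>c \<noteq> 0\<close> k0[of i0] by simp
    then have "?e i0 \<in> orbit (?e i0)"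
      using normal_eq_0_iff[of "?e i0" "?e i0"] e0 notin_bad_span_iff by (simp add: scalar_product_linear)
    then show False using not_in_orbit e0 by blast
  qed
  then have "\<exists>G'. G ** G' = mat 1"
    by (simp add: matrix_left_invertible_ker flip: left_invertible_transpose)
  then have "invertible G" using matrix_left_right_inverse unfolding invertible_def by blast
  then show thesis using alt that by blast
qed

end

section \<open>The two inclusions of the classification\<close>

lemma irreducible_maximal_imp_alternate:
  fixes H :: "('a::field^'n^'n) set"
  assumes three: "\<exists>a b c :: 'a. a \<noteq> b \<and> a \<noteq> c \<and> b \<noteq> c"
    and max: "maximal_trivial_spectrum_subspace H" and irr: "irreducible_matrices H"
  shows "\<exists>P. H = (\<lambda>A. P ** A) ` alternate_matrices \<and> invertible P \<and> non_isotropic P"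
proof -
  interpret irreducible_maximal_space H
    using assms unfolding maximal_trivial_spectrum_subspace_def trivial_spectrum_def
    by unfold_locales blast+
  obtain G where G: "invertible G" "\<And>M. M \<in> H \<Longrightarrow> alternate (G ** M)"
    using exists_alternating_multiplier by blast
  obtain P where P: "G ** P = mat 1" "P ** G = mat 1" using G(1) unfolding invertible_def by blast
  have invP: "invertible P" using P unfolding invertible_def by blast
  have "H \<subseteq> (\<lambda>A. P ** A) ` alternate_matrices"
  proof
    fix M assume "M \<in> H"
    then have "G ** M \<in> alternate_matrices" using G(2) by (simp add: alternate_matrices_def)
    moreover have "M = P ** (G ** M)" using P by (simp add: matrix_mul_assoc)
    ultimately show "M \<in> (\<lambda>A. P ** A) ` alternate_matrices" by blast
  qed
  then have H: "H = (\<lambda>A. P ** A) ` alternate_matrices"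
    using subspace_V dim_V dim_image_invertible[OF invP] subspace_alternate dim_alternate[where 'a='a and 'n='n]
    by (intro mat_vs.subspace_dim_equal) simp_all
  \<comment> \<open>An isotropic \<open>X\<close> would admit an alternate \<open>A\<close> sending
    \<open>P *v X\<close> back to \<open>X\<close>, so that \<open>P ** A\<close> fixes
    \<open>P *v X\<close>.\<close>
  have "non_isotropic P"
    unfolding non_isotropic_def
  proof (intro allI impI notI)
    fix X assume X: "X \<noteq> 0" and 0: "scalar_product X (P *v X) = 0"
    have PX: "P *v X \<noteq> 0"
      using X P(1) by (metis matrix_vector_mul_assoc matrix_vector_mul_lid matrix_vector_mult_0_right)
    obtain A where A: "alternate A" "A *v (P *v X) = X"
      using exists_alternate_mapping[OF PX 0] by blast
    have "P ** A \<in> H" using H A(1) by (auto simp: alternate_matrices_def)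
    moreover have "(P ** A) *v (P *v X) = P *v X"
      using A(2) by (simp flip: matrix_vector_mul_assoc)
    ultimately show False using no_fixed_vector PX by blast
  qed
  then show ?thesis using H invP by blast
qed

text \<open>If \<open>P ** A\<close> fixes \<open>X\<close>, then \<open>Y = A *v X\<close>
  satisfies \<open>P *v Y = X\<close> and is orthogonal to \<open>X\<close>, so it is isotropic for
  \<open>P\<close>. For irreducibility, a proper nonzero invariant subspace likewise yields an
  isotropic vector, namely any nonzero \<open>Z\<close> orthogonal to it.\<close>

lemma alternate_imp_irreducible_maximal:
  fixes P :: "'a::field^'n^'n"
  assumes inv: "invertible P" and iso: "non_isotropic P"
  shows "maximal_trivial_spectrum_subspace ((\<lambda>A. P ** A) ` alternate_matrices)"
    and "irreducible_matrices ((\<lambda>A. P ** A) ` alternate_matrices)"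
proof -
  let ?H = "(\<lambda>A. P ** A) ` alternate_matrices"
  have "X = 0" if A: "alternate A" and X: "(P ** A) *v X = X" for A X
  proof (rule ccontr)
    assume "X \<noteq> 0"
    let ?Y = "A *v X"
    have PY: "P *v ?Y = X" using X by (simp add: matrix_vector_mul_assoc)
    have "scalar_product ?Y (P *v ?Y) = 0"
      using A unfolding PY alternate_def by (simp add: scalar_product_commute[of _ X])
    moreover have "?Y \<noteq> 0" using PY \<open>X \<noteq> 0\<close> by auto
    ultimately show False using iso unfolding non_isotropic_def by blast
  qed
  then have "trivial_spectrum ?H"
    unfolding trivial_spectrum_def alternate_matrices_def by blast
  then show "maximal_trivial_spectrum_subspace ?H"
    using dim_image_invertible[OF inv] subspace_alternate
    by (simp add: maximal_trivial_spectrum_subspace_def dim_alternate)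
  show "irreducible_matrices ?H"
    unfolding irreducible_matrices_def
  proof (intro allI impI, rule ccontr)
    fix W assume "vec.subspace W \<and> (\<forall>M\<in>?H. \<forall>X\<in>W. M *v X \<in> W)"
      and nW: "\<not> (W = {0} \<or> W = UNIV)"
    then have W: "vec.subspace W" "\<And>M X. M \<in> ?H \<Longrightarrow> X \<in> W \<Longrightarrow> M *v X \<in> W" by blast+
    obtain X where X: "X \<in> W" "X \<noteq> 0" using nW vec.subspace_0[OF W(1)] by blast
    obtain z where "z \<notin> W" using nW by blast
    then obtain Z where Z: "\<And>h. h \<in> W \<Longrightarrow> scalar_product Z h = 0" "scalar_product Z z = 1"
      using exists_separating_functional[OF W(1)] by metis
    have "Z \<noteq> 0" using Z(2) by (auto simp: scalar_product_linear)
    \<comment> \<open>Alternate matrices send \<open>X\<close> to every vector orthogonal to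
      \<open>X\<close>, so \<open>P\<close> maps the whole orthogonal of \<open>X\<close> into
      \<open>W\<close>. This forces \<open>Z v* P\<close> to be a multiple of
      \<open>X\<close>.\<close>
    have kill: "scalar_product (Z v* P) Y = 0" if Y: "scalar_product Y X = 0" for Y
    proof -
      obtain A where A: "alternate A" "A *v X = Y" using exists_alternate_mapping[OF X(2) Y] by blast
      have "(P ** A) *v X \<in> W" using W(2) X(1) A(1) by (auto simp: alternate_matrices_def)
      then have "P *v Y \<in> W" using A(2) by (simp flip: matrix_vector_mul_assoc)
      then show ?thesis using Z(1) by (simp flip: scalar_product_matrix_vector)
    qed
    have "Z v* P \<in> vec.span {X}"
    proof (rule ccontr)
      assume "Z v* P \<notin> vec.span {X}"
      then obtain Y where "\<And>h. h \<in> vec.span {X} \<Longrightarrow> scalar_product Y h = 0"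
          "scalar_product Y (Z v* P) = 1"
        using exists_separating_functional[OF vec.subspace_span] by metis
      then show False using kill[of Y] by (simp add: vec.span_base scalar_product_commute[of Y "Z v* P"])
    qed
    then obtain c where c: "Z v* P = c *s X" unfolding vec.span_singleton by blast
    have "scalar_product Z (P *v Z) = c * scalar_product X Z"
      unfolding scalar_product_matrix_vector c by (simp add: scalar_product_linear)
    also have "\<dots> = 0" using Z(1)[OF X(1)] by (simp add: scalar_product_commute[of X])
    finally show False using iso \<open>Z \<noteq> 0\<close> unfolding non_isotropic_def by blast
  qed
qed

theorem theorem3:
  assumes "\<exists>a b c :: 'a::field. a \<noteq> b \<and> a \<noteq> c \<and> b \<noteq> c"
  shows "{H :: ('a^'n^'n) set. maximal_trivial_spectrum_subspace H \<and> irreducible_matrices H}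
       = {(\<lambda>A. P ** A) ` alternate_matrices | P :: 'a^'n^'n. invertible P \<and> non_isotropic P}"
proof (intro set_eqI iffI)
  fix H :: "('a^'n^'n) set"
  assume "H \<in> {H. maximal_trivial_spectrum_subspace H \<and> irreducible_matrices H}"
  then have "\<exists>P. H = (\<lambda>A. P ** A) ` alternate_matrices \<and> invertible P \<and> non_isotropic P"
    using irreducible_maximal_imp_alternate[OF assms] by blast
  then show "H \<in> {(\<lambda>A. P ** A) ` alternate_matrices | P. invertible P \<and> non_isotropic P}" by blast
next
  fix H :: "('a^'n^'n) set"
  assume "H \<in> {(\<lambda>A. P ** A) ` alternate_matrices | P. invertible P \<and> non_isotropic P}"
  then obtain P where "H = (\<lambda>A. P ** A) ` alternate_matrices" "invertible P" "non_isotropic P"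
    by blast
  then show "H \<in> {H. maximal_trivial_spectrum_subspace H \<and> irreducible_matrices H}"
    using alternate_imp_irreducible_maximal by blast
qed

end
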